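(* Consider a two-receiver broadcast channel with in-block memory of block length $L$ with dedicated messages only (no common message), that is deterministic in the sense that within each block the receiver outputs $Y_{1,i}$ and $Y_{2,i}$ are functions of $X^i=(X_1,\dots,X_i)$ for all $i=1,\dots,L$. Its capacity region is $$\bigcup_{P_{X^L}}\left\{(R_1,R_2):\begin{array}{l}0\le R_1\le H(Y_1^L)/L\\ 0\le R_2\le H(Y_2^L)/L\\ R_1+R_2\le H(Y_1^LY_2^L)/L\end{array}\right\},$$ both with and without feedback to the transmitter (feedback does not increase the capacity region).
   Context: Model. The transmitter has two independent messages $W_1,W_2$, uniformly distributed with entropies $nR_1,nR_2$ bits; receiver $k\in\{1,2\}$ decodes $W_k$ from its outputs $Y_k^n$. The number of channel uses is $n=mL$. At time $i$ the transmitter sends a symbol that is a function of $(W_1,W_2)$ and, with feedback, of its own past channel outputs $Y^{i-1}$. The channel has memory inside blocks of length $L$ and none across blocks: the transmitter's feedback output at position $i$ of a block is a fixed function of the first $i$ inputs of that block and of a noise variable that is i.i.d. across blocks and independent of the messages; the receivers' outputs at position $i$ of a block are $Y_{k,i}=f_{k,i}(X_1,\dots,X_i)$, $k=1,2$, where $X_1,\dots,X_L$ are the inputs in that block. All alphabets are finite. The capacity region is the closure of the set of $(R_1,R_2)$ such that for every $\epsilon>0$ there are an $n$ (a multiple of $L$), an encoder and decoders with probability of any decoding error at most $\epsilon$. In the region, $Y_k^L=(Y_{k,1},\dots,Y_{k,L})$ is the output block for random input block $X^L\sim P_{X^L}$, and $H$ is entropy in bits. *)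

theory Defs
  imports "HOL-Probability.Probability"
begin

(* Times are counted from 0, so time t is position (t mod L + 1) of block (t div L).
   block_prefix L t xs is the list of inputs of that block up to and including time t. *)
definition block_prefix :: "nat \<Rightarrow> nat \<Rightarrow> 'x list \<Rightarrow> 'x list" where
  "block_prefix L t xs = drop (t div L * L) (take (Suc t) xs)"

(* f i is the output function of position i \<in> {1..L}; it is only ever applied to lists of
   length i. The same applies to the feedback function below. *)
definition receive :: "nat \<Rightarrow> (nat \<Rightarrow> 'x list \<Rightarrow> 'y) \<Rightarrow> 'x list \<Rightarrow> 'y list" where
  "receive L f xs = map (\<lambda>t. f (t mod L + 1) (block_prefix L t xs)) [0..<length xs]"

(* The inputs and the transmitter's feedback outputs of the first t channel uses, for fixed
   messages and fixed noise (zs ! b is the noise of block b). The encoder g sees the past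
   feedback outputs, whose number also tells it the time. *)
primrec fb_run :: "nat \<Rightarrow> (nat \<Rightarrow> 'x list \<Rightarrow> 'z \<Rightarrow> 'f) \<Rightarrow> ('f list \<Rightarrow> 'x) \<Rightarrow> 'z list \<Rightarrow> nat
    \<Rightarrow> 'x list \<times> 'f list" where
  "fb_run L fb g zs 0 = ([], [])"
| "fb_run L fb g zs (Suc t) =
     (let (xs, ys) = fb_run L fb g zs t;
          xs' = xs @ [g ys]
      in (xs', ys @ [fb (t mod L + 1) (block_prefix L t xs') (zs ! (t div L))]))"

(* A transmitter is the map from the two messages and the block noises to the n channel inputs
   that results from an encoder. *)
definition fb_transmitters ::
  "nat \<Rightarrow> (nat \<Rightarrow> 'x list \<Rightarrow> 'z \<Rightarrow> 'f) \<Rightarrow> nat \<Rightarrow> (nat \<Rightarrow> nat \<Rightarrow> 'z list \<Rightarrow> 'x list) set" where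
  "fb_transmitters L fb n =
     {\<lambda>w1 w2 zs. fst (fb_run L fb (enc w1 w2) zs n) | enc. True}"

definition nofb_transmitters :: "nat \<Rightarrow> (nat \<Rightarrow> nat \<Rightarrow> 'z list \<Rightarrow> 'x list) set" where
  "nofb_transmitters n = {\<lambda>w1 w2 zs. map (enc w1 w2) [0..<n] | enc. True}"

(* Probability of any decoding error with m blocks, for independent messages uniform on
   {..<M1} and {..<M2}, and independent block noises with distribution N. *)
definition error_prob ::
  "nat \<Rightarrow> (nat \<Rightarrow> 'x list \<Rightarrow> 'y1) \<Rightarrow> (nat \<Rightarrow> 'x list \<Rightarrow> 'y2) \<Rightarrow> 'z pmf \<Rightarrow> nat \<Rightarrow> nat \<Rightarrow> nat
    \<Rightarrow> (nat \<Rightarrow> nat \<Rightarrow> 'z list \<Rightarrow> 'x list) \<Rightarrow> ('y1 list \<Rightarrow> nat) \<Rightarrow> ('y2 list \<Rightarrow> nat) \<Rightarrow> real" where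
  "error_prob L f1 f2 N m M1 M2 tx d1 d2 =
     measure_pmf.prob
       (pair_pmf (pmf_of_set {..<M1}) (pair_pmf (pmf_of_set {..<M2}) (replicate_pmf m N)))
       {(w1, w2, zs). d1 (receive L f1 (tx w1 w2 zs)) \<noteq> w1 \<or> d2 (receive L f2 (tx w1 w2 zs)) \<noteq> w2}"

(* T n is the set of admissible transmitters for n channel uses. *)
definition achievable ::
  "nat \<Rightarrow> (nat \<Rightarrow> 'x list \<Rightarrow> 'y1) \<Rightarrow> (nat \<Rightarrow> 'x list \<Rightarrow> 'y2) \<Rightarrow> 'z pmf
    \<Rightarrow> (nat \<Rightarrow> (nat \<Rightarrow> nat \<Rightarrow> 'z list \<Rightarrow> 'x list) set) \<Rightarrow> real \<Rightarrow> real \<Rightarrow> bool" where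
  "achievable L f1 f2 N T R1 R2 \<longleftrightarrow>
     (\<forall>\<epsilon>>0. \<exists>m M1 M2. 0 < m \<and> 0 < M1 \<and> 0 < M2 \<and>
        log 2 (real M1) = real (m * L) * R1 \<and> log 2 (real M2) = real (m * L) * R2 \<and>
        (\<exists>tx \<in> T (m * L). \<exists>d1 d2. error_prob L f1 f2 N m M1 M2 tx d1 d2 \<le> \<epsilon>))"

definition capacity_region_fb ::
  "nat \<Rightarrow> (nat \<Rightarrow> 'x list \<Rightarrow> 'y1) \<Rightarrow> (nat \<Rightarrow> 'x list \<Rightarrow> 'y2) \<Rightarrow> (nat \<Rightarrow> 'x list \<Rightarrow> 'z \<Rightarrow> 'f) \<Rightarrow> 'z pmf
    \<Rightarrow> (real \<times> real) set" where
  "capacity_region_fb L f1 f2 fb N =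
     closure {(R1, R2). achievable L f1 f2 N (fb_transmitters L fb) R1 R2}"

definition capacity_region_nofb ::
  "nat \<Rightarrow> (nat \<Rightarrow> 'x list \<Rightarrow> 'y1) \<Rightarrow> (nat \<Rightarrow> 'x list \<Rightarrow> 'y2) \<Rightarrow> 'z pmf \<Rightarrow> (real \<times> real) set" where
  "capacity_region_nofb L f1 f2 N =
     closure {(R1, R2). achievable L f1 f2 N nofb_transmitters R1 R2}"

definition bit_entropy :: "'a pmf \<Rightarrow> ('a \<Rightarrow> 'b) \<Rightarrow> real" where
  "bit_entropy P Y = prob_space.entropy (measure_pmf P) 2 (count_space UNIV) Y"

(* The reference measure of the library's entropy has to be sigma-finite, hence the countable
   range; output blocks, being lists over finite types, have it. *)
lemma bit_entropy_eq_sum: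
  fixes Y :: "'a \<Rightarrow> 'b::countable"
  assumes "finite (set_pmf P)"
  shows "bit_entropy P Y =
    - (\<Sum>y\<in>Y ` set_pmf P. pmf (map_pmf Y P) y * log 2 (pmf (map_pmf Y P) y))"
proof -
  interpret information_space "measure_pmf P" 2
    by (simp add: information_space_def information_space_axioms_def measure_pmf.prob_space_axioms)
  interpret C: sigma_finite_measure "count_space (UNIV :: 'b set)"
    by (rule sigma_finite_measure_count_space)
  have "distr (measure_pmf P) (count_space UNIV) Y
      = density (count_space UNIV) (\<lambda>y. ennreal (pmf (map_pmf Y P) y))"
    by (simp add: map_pmf_rep_eq[symmetric] measure_pmf_eq_density[symmetric])
  then have "distributed (measure_pmf P) (count_space UNIV) Y (\<lambda>y. ennreal (pmf (map_pmf Y P) y))"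
    by (simp add: distributed_def)
  then have "bit_entropy P Y
      = - (\<integral>y. pmf (map_pmf Y P) y * log 2 (pmf (map_pmf Y P) y) \<partial>count_space UNIV)"
    unfolding bit_entropy_def by (rule entropy_distr) simp
  also have "(\<integral>y. pmf (map_pmf Y P) y * log 2 (pmf (map_pmf Y P) y) \<partial>count_space UNIV)
      = (\<Sum>y\<in>Y ` set_pmf P. pmf (map_pmf Y P) y * log 2 (pmf (map_pmf Y P) y))"
    by (rule lebesgue_integral_count_space_finite_support[THEN trans])
      (auto simp: assms pmf_eq_0_set_pmf
        intro!: sum.mono_neutral_left finite_subset[OF _ finite_imageI[OF assms, of Y]])
  finally show ?thesis .
qed

(* For xs of length L, receive L f xs is the output block of a single block. *)
definition rate_region ::
  "nat \<Rightarrow> (nat \<Rightarrow> 'x list \<Rightarrow> 'y1) \<Rightarrow> (nat \<Rightarrow> 'x list \<Rightarrow> 'y2) \<Rightarrow> 'x list pmf \<Rightarrow> (real \<times> real) set" where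
  "rate_region L f1 f2 P = {(R1, R2).
     0 \<le> R1 \<and> R1 \<le> bit_entropy P (receive L f1) / real L \<and>
     0 \<le> R2 \<and> R2 \<le> bit_entropy P (receive L f2) / real L \<and>
     R1 + R2 \<le> bit_entropy P (\<lambda>xs. (receive L f1 xs, receive L f2 xs)) / real L}"

end

(* Achievability hashes output words at random: message w_k is the hash value of the block output
   word Y_k^m. A message pair can be sent as soon as some typical input word has the two right hash
   values, and then decoding is error-free because the channel is deterministic. A second-moment
   (leftover hash) estimate bounds the fraction of pairs that are missed, using only upper bounds on
   the probabilities of the fibres of Y_1^m, Y_2^m and (Y_1^m, Y_2^m) over typical words.

   The converse fixes the noise and restricts to the correctly decoded message pairs. On these the
   output words determine the messages, so their fibres are small, and Gibbs' inequality against
   the product of the time-averaged block law turns this into an entropy bound for one block. It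
   holds for every transmitter, so feedback is irrelevant. Compactness of the set of block laws
   removes the slack. *)
theory Submission
  imports Defs "HOL-Real_Asymp.Real_Asymp"
begin

section \<open>Words over a finite alphabet\<close>

definition words :: "'a set \<Rightarrow> nat \<Rightarrow> 'a list set" where
  "words A n = {xs. set xs \<subseteq> A \<and> length xs = n}"

lemma finite_words [simp]: "finite A \<Longrightarrow> finite (words A n)"
  unfolding words_def by (rule finite_lists_length_eq)

lemma words_0 [simp]: "words A 0 = {[]}"
  by (auto simp: words_def)

lemma sum_words_Suc:
  "(\<Sum>xs\<in>words A (Suc n). F xs) = (\<Sum>x\<in>A. \<Sum>xs\<in>words A n. F (x # xs))"
proof -
  have "words A (Suc n) = (\<lambda>(x, xs). x # xs) ` (A \<times> words A n)"
    by (force simp: words_def image_iff length_Suc_conv)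
  then have "(\<Sum>xs\<in>words A (Suc n). F xs) = (\<Sum>(x, xs)\<in>A \<times> words A n. F (x # xs))"
    by (simp add: sum.reindex inj_on_def case_prod_unfold)
  then show ?thesis
    by (simp add: sum.cartesian_product)
qed

lemma sum_words_prod_list:
  fixes p :: "'a \<Rightarrow> real"
  shows "(\<Sum>xs\<in>words A n. prod_list (map p xs)) = (\<Sum>x\<in>A. p x) ^ n"
  by (induction n) (simp_all add: sum_words_Suc sum_distrib_left[symmetric] sum_distrib_right[symmetric])

text \<open>The weight is a product and \<open>map Y xs = ys\<close> constrains each letter
  separately, so the sum factorises over positions. This later gives exact fibre probabilities under
  a product law.\<close>

lemma sum_words_fibre:
  fixes p :: "'a \<Rightarrow> real"
  shows "(\<Sum>xs\<in>words A (length ys). of_bool (map Y xs = ys) * prod_list (map p xs))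
    = prod_list (map (\<lambda>y. \<Sum>x\<in>A. of_bool (Y x = y) * p x) ys)"
proof (induction ys)
  case (Cons y ys)
  have *: "of_bool (Y x = y \<and> map Y xs = ys) * (p x * prod_list (map p xs)) =
     (of_bool (Y x = y) * p x) * (of_bool (map Y xs = ys) * prod_list (map p xs))" for x xs
    by (simp add: of_bool_def)
  show ?case
    by (simp add: sum_words_Suc Cons.IH[symmetric] * sum_product)
qed simp

section \<open>Second moments and Chebyshev's inequality for words\<close>

text \<open>Variances of independent centred letters add: when a letter is prepended, the cross term
  carries the factor \<open>\<Sum>x\<in>A. p x * g x\<close>, which vanishes.\<close>

lemma second_moment_words:
  fixes p g :: "'a \<Rightarrow> real"
  assumes "(\<Sum>x\<in>A. p x) = 1" and "(\<Sum>x\<in>A. p x * g x) = 0"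
  shows "(\<Sum>xs\<in>words A n. prod_list (map p xs) * (sum_list (map g xs))\<^sup>2)
    = real n * (\<Sum>x\<in>A. p x * (g x)\<^sup>2)"
proof (induction n)
  case (Suc n)
  let ?w = "\<lambda>xs. prod_list (map p xs)" and ?S = "\<lambda>xs. sum_list (map g xs)"
  have w: "(\<Sum>xs\<in>words A n. ?w xs) = 1"
    by (simp add: sum_words_prod_list assms)
  have "(\<Sum>xs\<in>words A (Suc n). ?w xs * (?S xs)\<^sup>2)
      = (\<Sum>x\<in>A. \<Sum>xs\<in>words A n. p x * (g x)\<^sup>2 * ?w xs + 2 * (p x * g x) * (?w xs * ?S xs)
          + p x * (?w xs * (?S xs)\<^sup>2))"
    by (simp add: sum_words_Suc power2_eq_square algebra_simps)
  also have "\<dots> = (\<Sum>x\<in>A. p x * (g x)\<^sup>2) * (\<Sum>xs\<in>words A n. ?w xs)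
      + 2 * (\<Sum>x\<in>A. p x * g x) * (\<Sum>xs\<in>words A n. ?w xs * ?S xs)
      + (\<Sum>x\<in>A. p x) * (\<Sum>xs\<in>words A n. ?w xs * (?S xs)\<^sup>2)"
    unfolding sum.distrib by (simp only: sum_distrib_left[of 2] mult.assoc[of 2, symmetric] sum_product)
  finally show ?case
    unfolding w assms Suc.IH by (simp add: algebra_simps)
qed simp

text \<open>Only the lower tail is bounded: hashing needs upper bounds on fibre probabilities, that
  is, lower bounds on information sums.\<close>

lemma chebyshev_words:
  fixes p g :: "'a \<Rightarrow> real"
  assumes "finite A" and p0: "\<And>x. x \<in> A \<Longrightarrow> 0 \<le> p x" and "(\<Sum>x\<in>A. p x) = 1"
    and "0 < \<delta>" "0 < n" and \<mu>: "\<mu> = (\<Sum>x\<in>A. p x * g x)"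
  shows "(\<Sum>xs\<in>words A n. of_bool (sum_list (map g xs) < real n * (\<mu> - \<delta>)) * prod_list (map p xs))
    \<le> (\<Sum>x\<in>A. p x * (g x - \<mu>)\<^sup>2) / (real n * \<delta>\<^sup>2)"
proof -
  let ?w = "\<lambda>xs. prod_list (map p xs)" and ?g = "\<lambda>x. g x - \<mu>"
  have S: "sum_list (map ?g xs) = sum_list (map g xs) - real (length xs) * \<mu>" for xs
    by (induction xs) (auto simp: algebra_simps)
  have w0: "0 \<le> ?w xs" if "xs \<in> words A n" for xs
    using that p0 by (intro prod_list_nonneg) (auto simp: words_def)
  have "(\<Sum>x\<in>A. p x * ?g x) = 0"
    using assms by (simp add: right_diff_distrib sum_subtractf flip: sum_distrib_right)
  then have sm: "(\<Sum>xs\<in>words A n. ?w xs * (sum_list (map ?g xs))\<^sup>2) = real n * (\<Sum>x\<in>A. p x * (?g x)\<^sup>2)"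
    using second_moment_words[of p A ?g n] assms by simp
  have "(\<Sum>xs\<in>words A n. of_bool (sum_list (map g xs) < real n * (\<mu> - \<delta>)) * ?w xs) * (real n * \<delta>)\<^sup>2
      \<le> (\<Sum>xs\<in>words A n. ?w xs * (sum_list (map ?g xs))\<^sup>2)"
    unfolding sum_distrib_right
  proof (rule sum_mono)
    fix xs assume xs: "xs \<in> words A n"
    have "(real n * \<delta>)\<^sup>2 \<le> (sum_list (map ?g xs))\<^sup>2"
      if "sum_list (map g xs) < real n * (\<mu> - \<delta>)"
    proof -
      have "real n * \<delta> \<le> \<bar>sum_list (map ?g xs)\<bar>"
        using that xs unfolding S by (simp add: words_def algebra_simps)
      then show ?thesis
        using assms by (intro abs_le_square_iff[THEN iffD1]) simp
    qed
    with w0[OF xs] show "of_bool (sum_list (map g xs) < real n * (\<mu> - \<delta>)) * ?w xs * (real n * \<delta>)\<^sup>2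
        \<le> ?w xs * (sum_list (map ?g xs))\<^sup>2"
      by (auto simp: of_bool_def intro!: mult_left_mono)
  qed
  also note sm
  finally show ?thesis
    using assms by (simp add: field_simps power2_eq_square)
qed

section \<open>Collisions of uniformly random functions\<close>

text \<open>A function with \<open>b s = b t\<close> is determined by its values off
  \<open>s\<close>, and those values are arbitrary.\<close>

lemma card_PiE_collision:
  assumes "finite S" "s \<in> S" "t \<in> S" "s \<noteq> t"
  shows "card {b \<in> S \<rightarrow>\<^sub>E {..<M::nat}. b s = b t} * M = card (S \<rightarrow>\<^sub>E {..<M})"
proof -
  let ?F = "(S - {s}) \<rightarrow>\<^sub>E {..<M}"
  have S: "S = insert s (S - {s})"
    using assms by auto
  have "{b \<in> S \<rightarrow>\<^sub>E {..<M}. b s = b t} = (\<lambda>h. h(s := h t)) ` ?F" (is "?C = _")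
  proof (intro equalityI subsetI)
    fix b assume b: "b \<in> ?C"
    then have "b(s := undefined) \<in> ?F"
      by (auto simp: PiE_iff extensional_def)
    moreover have "b = (b(s := undefined))(s := (b(s := undefined)) t)"
      using b assms by (simp add: fun_eq_iff)
    ultimately show "b \<in> (\<lambda>h. h(s := h t)) ` ?F"
      by blast
  next
    fix b assume "b \<in> (\<lambda>h. h(s := h t)) ` ?F"
    then obtain h where h: "h \<in> ?F" "b = h(s := h t)"
      by blast
    have "h t \<in> {..<M}"
      using PiE_mem[OF h(1)] assms by simp
    then have "b \<in> insert s (S - {s}) \<rightarrow>\<^sub>E {..<M}"
      unfolding h(2) using h(1) by (intro PiE_fun_upd) auto
    then show "b \<in> ?C"
      unfolding S[symmetric] using h assms by simp
  qed
  moreover have "inj_on (\<lambda>h. h(s := h t)) ?F"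
  proof (rule inj_onI)
    fix h k assume h: "h \<in> ?F" and k: "k \<in> ?F" and eq: "h(s := h t) = k(s := k t)"
    \<comment> \<open>Both functions are \<open>undefined\<close> at \<open>s\<close>, so
      overwriting that value loses nothing.\<close>
    have "h s = k s"
      using PiE_arb[OF h, of s] PiE_arb[OF k, of s] by simp
    then show "h = k"
      using eq by (auto simp: fun_eq_iff split: if_splits)
  qed
  ultimately have "card {b \<in> S \<rightarrow>\<^sub>E {..<M}. b s = b t} = M ^ card (S - {s})"
    using assms by (simp add: card_image card_PiE)
  then show ?thesis
    using assms by (auto simp: card_PiE power_eq_if[of M "card S"])
qed

text \<open>A random hash function collides with probability 1 on equal arguments and
  \<open>1 / M\<close> on distinct ones. Writing this affinely in \<open>of_bool\<close> makes the
  product over two independent hashes easy to expand.\<close>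

lemma sum_PiE_collision:
  assumes "finite S" "s \<in> S" "t \<in> S" "0 < M"
  shows "(\<Sum>b\<in>S \<rightarrow>\<^sub>E {..<M::nat}. of_bool (b s = b t))
    = real (card (S \<rightarrow>\<^sub>E {..<M})) * (1 / M + (1 - 1 / M) * of_bool (s = t))"
proof (cases "s = t")
  case False
  have "real (card {b \<in> S \<rightarrow>\<^sub>E {..<M}. b s = b t}) * M = card (S \<rightarrow>\<^sub>E {..<M})"
    using arg_cong[OF card_PiE_collision[OF assms(1-3) False, of M], of real] by (simp only: of_nat_mult)
  then show ?thesis
    using assms False finite_PiE[OF assms(1), of "\<lambda>_. {..<M}"]
    by (simp add: Int_def eq_divide_eq card_PiE)
qed simp

section \<open>Random hashing\<close>

text \<open>Second-moment method: the mass \<open>Z i\<close> hashed to \<open>i\<close> averages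
  \<open>c / card I\<close> over \<open>I\<close>, and the double sum is the sum of the squares of
  the \<open>Z i\<close>. Masses of small variance leave few values of \<open>i\<close> without any
  mass.\<close>

lemma card_missed:
  fixes w :: "'a \<Rightarrow> real"
  assumes "finite T" "finite I" and \<beta>: "\<beta> ` T \<subseteq> I" and c: "c = (\<Sum>x\<in>T. w x)"
  shows "real (card (I - \<beta> ` T)) * c\<^sup>2
    \<le> real (card I) * (real (card I) * (\<Sum>x\<in>T. \<Sum>x'\<in>T. w x * w x' * of_bool (\<beta> x = \<beta> x')) - c\<^sup>2)"
proof -
  define m where "m = real (card I)"
  define Z where "Z i = (\<Sum>x\<in>T. w x * of_bool (\<beta> x = i))" for i
  define S where "S = (\<Sum>x\<in>T. \<Sum>x'\<in>T. w x * w x' * of_bool (\<beta> x = \<beta> x'))"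
  have delta: "(\<Sum>i\<in>I. of_bool (\<beta> x = i) * f i) = (f (\<beta> x) :: real)" if "x \<in> T" for x f
    using that \<beta> \<open>finite I\<close> by (subst sum.remove[of _ "\<beta> x"]) auto
  have Z1: "(\<Sum>i\<in>I. Z i) = c"
    unfolding Z_def c using delta[of _ "\<lambda>_. 1"]
    by (subst sum.swap) (simp flip: sum_distrib_left)
  have "(\<Sum>i\<in>I. (Z i)\<^sup>2)
      = (\<Sum>i\<in>I. \<Sum>x\<in>T. \<Sum>x'\<in>T. w x * w x' * (of_bool (\<beta> x = i) * of_bool (\<beta> x' = i)))"
    by (simp add: Z_def power2_eq_square sum_product mult_ac)
  also have "\<dots> = (\<Sum>x\<in>T. \<Sum>x'\<in>T. \<Sum>i\<in>I. w x * w x' * (of_bool (\<beta> x = i) * of_bool (\<beta> x' = i)))"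
    by (subst sum.swap, intro sum.cong refl sum.swap)
  also have "\<dots> = S"
    unfolding S_def
    by (intro sum.cong refl) (simp only: sum_distrib_left[symmetric] delta, simp only: eq_commute)
  finally have Z2: "(\<Sum>i\<in>I. (Z i)\<^sup>2) = S" .
  \<comment> \<open>Each missed \<open>i\<close> contributes \<open>c\<^sup>2\<close> to the variance of the masses \<open>Z i\<close>.\<close>
  have "real (card (I - \<beta> ` T)) * c\<^sup>2 = (\<Sum>i\<in>I - \<beta> ` T. (m * Z i - c)\<^sup>2)"
  proof -
    have "Z i = 0" if "i \<in> I - \<beta> ` T" for i
      unfolding Z_def using that by (intro sum.neutral) auto
    then show ?thesis by simp
  qed
  also have "\<dots> \<le> (\<Sum>i\<in>I. (m * Z i - c)\<^sup>2)"
    using assms by (intro sum_mono2) auto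
  also have "\<dots> = (\<Sum>i\<in>I. m\<^sup>2 * (Z i)\<^sup>2 - 2 * m * c * Z i + c\<^sup>2)"
    by (simp add: power2_eq_square algebra_simps)
  also have "\<dots> = m\<^sup>2 * (\<Sum>i\<in>I. (Z i)\<^sup>2) - 2 * m * c * (\<Sum>i\<in>I. Z i) + m * c\<^sup>2"
    by (simp only: sum.distrib sum_subtractf sum_distrib_left sum_constant m_def)
  also have "\<dots> = m * (m * S - c\<^sup>2)"
    unfolding Z1 Z2 by (simp add: power2_eq_square algebra_simps)
  finally show ?thesis
    unfolding m_def S_def .
qed

text \<open>Average the collision mass over independent uniform hashes of \<open>u\<close> and
  \<open>v\<close>. The constant term of the expanded collision probability contributes
  \<open>c\<^sup>2 / (M1 * M2)\<close>, which cancels against the squared mean in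
  \<open>card_missed\<close>; the excess \<open>D\<close> remains. The factors
  \<open>real M1 - 1\<close> and \<open>real M2 - 1\<close> are kept because they vanish for a
  trivial message set.\<close>

lemma hash_covers:
  fixes w :: "'a \<Rightarrow> real" and u :: "'a \<Rightarrow> 'u" and v :: "'a \<Rightarrow> 'v"
  assumes fT: "finite T" and w0: "\<And>x. x \<in> T \<Longrightarrow> 0 \<le> w x" and M: "0 < M1" "0 < M2"
    and a1: "\<And>x. x \<in> T \<Longrightarrow> (\<Sum>x'\<in>T. of_bool (u x = u x') * w x') \<le> a1"
    and a2: "\<And>x. x \<in> T \<Longrightarrow> (\<Sum>x'\<in>T. of_bool (v x = v x') * w x') \<le> a2"
    and a12: "\<And>x. x \<in> T \<Longrightarrow> (\<Sum>x'\<in>T. of_bool (u x = u x' \<and> v x = v x') * w x') \<le> a12"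
    and c: "c = (\<Sum>x\<in>T. w x)" "0 < c"
  obtains b1 :: "'u \<Rightarrow> nat" and b2 :: "'v \<Rightarrow> nat" where
    "real (card ({..<M1} \<times> {..<M2} - (\<lambda>x. (b1 (u x), b2 (v x))) ` T)) * c
      \<le> M1 * M2 * ((real M1 - 1) * a1 + (real M2 - 1) * a2 + (real M1 - 1) * (real M2 - 1) * a12)"
proof -
  define D where "D = (real M1 - 1) * a1 + (real M2 - 1) * a2 + (real M1 - 1) * (real M2 - 1) * a12"
  define F1 where "F1 = u ` T \<rightarrow>\<^sub>E {..<M1}"
  define F2 where "F2 = v ` T \<rightarrow>\<^sub>E {..<M2}"
  define S where "S b = (\<Sum>x\<in>T. \<Sum>x'\<in>T. w x * w x' * of_bool ((fst b (u x), snd b (v x)) = (fst b (u x'), snd b (v x'))))"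
    for b :: "('u \<Rightarrow> nat) \<times> ('v \<Rightarrow> nat)"
  have F: "finite F1" "finite F2" "F1 \<noteq> {}" "F2 \<noteq> {}"
    using fT M by (auto simp: F1_def F2_def PiE_eq_empty_iff intro!: finite_PiE)
  \<comment> \<open>For each hash, \<open>1 / M + (1 - 1 / M) * B = (1 + (M - 1) * B) / M\<close>;
    the four terms come from multiplying the two.\<close>
  have avg: "(\<Sum>b\<in>F1 \<times> F2. of_bool ((fst b (u x), snd b (v x)) = (fst b (u x'), snd b (v x'))))
      = real (card F1 * card F2) / (M1 * M2) *
        (1 + (real M1 - 1) * of_bool (u x = u x') + (real M2 - 1) * of_bool (v x = v x')
          + (real M1 - 1) * (real M2 - 1) * of_bool (u x = u x' \<and> v x = v x'))"
    if "x \<in> T" "x' \<in> T" for x x'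
  proof -
    have 1: "(\<Sum>b\<in>F1. of_bool (b (u x) = b (u x')))
        = real (card F1) * (1 / M1 + (1 - 1 / M1) * of_bool (u x = u x'))"
      unfolding F1_def using fT M that by (intro sum_PiE_collision) auto
    have 2: "(\<Sum>b\<in>F2. of_bool (b (v x) = b (v x')))
        = real (card F2) * (1 / M2 + (1 - 1 / M2) * of_bool (v x = v x'))"
      unfolding F2_def using fT M that by (intro sum_PiE_collision) auto
    have "(\<Sum>b\<in>F1 \<times> F2. of_bool ((fst b (u x), snd b (v x)) = (fst b (u x'), snd b (v x'))))
        = (\<Sum>b1\<in>F1. of_bool (b1 (u x) = b1 (u x'))) * (\<Sum>b2\<in>F2. of_bool (b2 (v x) = b2 (v x')) :: real)"
      by (simp add: sum_product sum.cartesian_product case_prod_unfold of_bool_conj)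
    then show ?thesis
      unfolding 1 2 of_bool_conj using M by (simp add: field_simps)
  qed
  have "(\<Sum>b\<in>F1 \<times> F2. S b) = (\<Sum>x\<in>T. \<Sum>x'\<in>T. w x * w x' *
      (\<Sum>b\<in>F1 \<times> F2. of_bool ((fst b (u x), snd b (v x)) = (fst b (u x'), snd b (v x')))))"
    unfolding S_def
    by (subst sum.swap, intro sum.cong refl, subst sum.swap) (simp only: sum_distrib_left)
  also have "\<dots> = (\<Sum>x\<in>T. \<Sum>x'\<in>T. w x * w x' * (real (card F1 * card F2) / (M1 * M2) *
        (1 + (real M1 - 1) * of_bool (u x = u x') + (real M2 - 1) * of_bool (v x = v x')
          + (real M1 - 1) * (real M2 - 1) * of_bool (u x = u x' \<and> v x = v x'))))"
    by (intro sum.cong refl) (simp only: avg)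
  also have "\<dots> = real (card F1 * card F2) / (M1 * M2) * (\<Sum>x\<in>T. w x * (\<Sum>x'\<in>T. w x' *
        (1 + (real M1 - 1) * of_bool (u x = u x') + (real M2 - 1) * of_bool (v x = v x')
          + (real M1 - 1) * (real M2 - 1) * of_bool (u x = u x' \<and> v x = v x'))))"
    unfolding sum_distrib_left by (intro sum.cong refl) (simp only: mult_ac)
  also have "\<dots> \<le> real (card F1 * card F2) / (M1 * M2) * (\<Sum>x\<in>T. w x * (c + D))"
  proof (intro mult_left_mono sum_mono w0)
    fix x assume x: "x \<in> T"
    have "(\<Sum>x'\<in>T. w x' *
        (1 + (real M1 - 1) * of_bool (u x = u x') + (real M2 - 1) * of_bool (v x = v x')
          + (real M1 - 1) * (real M2 - 1) * of_bool (u x = u x' \<and> v x = v x')))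
      = c + ((real M1 - 1) * (\<Sum>x'\<in>T. of_bool (u x = u x') * w x')
          + (real M2 - 1) * (\<Sum>x'\<in>T. of_bool (v x = v x') * w x')
          + (real M1 - 1) * (real M2 - 1) * (\<Sum>x'\<in>T. of_bool (u x = u x' \<and> v x = v x') * w x'))"
      unfolding c sum_distrib_left sum.distrib[symmetric]
      by (intro sum.cong refl) (simp only: distrib_left mult_ac add_ac mult_1_right mult_1_left)
    also have "\<dots> \<le> c + D"
      unfolding D_def using M a1[OF x] a2[OF x] a12[OF x]
      by (intro add_mono mult_left_mono order_refl) auto
    finally show "(\<Sum>x'\<in>T. w x' *
        (1 + (real M1 - 1) * of_bool (u x = u x') + (real M2 - 1) * of_bool (v x = v x')
          + (real M1 - 1) * (real M2 - 1) * of_bool (u x = u x' \<and> v x = v x'))) \<le> c + D" .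
  qed auto
  also have "(\<Sum>x\<in>T. w x * (c + D)) = c * (c + D)"
    by (simp add: c flip: sum_distrib_right)
  finally have le: "(\<Sum>b\<in>F1 \<times> F2. S b) \<le> real (card (F1 \<times> F2)) * (c * (c + D) / (M1 * M2))"
    by (simp add: card_cartesian_product)
  \<comment> \<open>Some pair of hash functions is no worse than the average.\<close>
  have "\<exists>b\<in>F1 \<times> F2. S b \<le> c * (c + D) / (M1 * M2)"
  proof (rule ccontr)
    assume "\<not> (\<exists>b\<in>F1 \<times> F2. S b \<le> c * (c + D) / (M1 * M2))"
    then have "c * (c + D) / (M1 * M2) < S b" if "b \<in> F1 \<times> F2" for b
      using that by (meson not_le)
    then have "(\<Sum>b\<in>F1 \<times> F2. c * (c + D) / (M1 * M2)) < (\<Sum>b\<in>F1 \<times> F2. S b)"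
      using F by (intro sum_strict_mono) simp_all
    with le show False by simp
  qed
  then obtain b1 b2 where b: "b1 \<in> F1" "b2 \<in> F2" "S (b1, b2) \<le> c * (c + D) / (M1 * M2)"
    by auto
  have "real (card ({..<M1} \<times> {..<M2} - (\<lambda>x. (b1 (u x), b2 (v x))) ` T)) * c\<^sup>2
      \<le> real (card ({..<M1} \<times> {..<M2})) * (real (card ({..<M1} \<times> {..<M2})) * S (b1, b2) - c\<^sup>2)"
    unfolding S_def fst_conv snd_conv using b(1,2) fT c(1)
    by (intro card_missed) (auto simp: F1_def F2_def PiE_iff)
  also have "\<dots> \<le> real (M1 * M2) * (real (M1 * M2) * (c * (c + D) / (M1 * M2)) - c\<^sup>2)"
    unfolding card_cartesian_product card_lessThan using b(3)
    by (intro mult_left_mono diff_right_mono) auto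
  also have "\<dots> = (real (M1 * M2) * D) * c"
    using M by (simp add: power2_eq_square field_simps)
  finally have "real (card ({..<M1} \<times> {..<M2} - (\<lambda>x. (b1 (u x), b2 (v x))) ` T)) * c \<le> M1 * M2 * D"
    using c(2) by (simp add: power2_eq_square)
  then show ?thesis
    using that[of b1 b2] by (simp add: D_def)
qed

section \<open>A code for one input law\<close>

text \<open>Self-information in bits, taken as a function of the input rather than of the output so
  that it can be summed along input words.\<close>

definition info :: "'a pmf \<Rightarrow> ('a \<Rightarrow> 'b) \<Rightarrow> 'a \<Rightarrow> real" where
  "info P Y x = - log 2 (pmf (map_pmf Y P) (Y x))"

text \<open>Entropy as the mean of \<open>info\<close>, the form to which Chebyshev's inequality
  applies; \<open>bit_entropy_eq_ent\<close> links it to \<open>bit_entropy\<close>.\<close>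

definition ent :: "'a pmf \<Rightarrow> ('a \<Rightarrow> 'b) \<Rightarrow> real" where
  "ent P Y = (\<Sum>x\<in>set_pmf P. pmf P x * info P Y x)"

lemma pmf_map_eq_sum:
  assumes "finite A" "set_pmf P \<subseteq> A"
  shows "pmf (map_pmf Y P) y = (\<Sum>x\<in>A. of_bool (Y x = y) * pmf P x)"
proof -
  have "pmf (map_pmf Y P) y = measure_pmf.prob P (Y -` {y} \<inter> A)"
    using assms unfolding pmf_map by (intro measure_prob_cong_0) (auto simp: set_pmf_iff)
  also have "\<dots> = (\<Sum>x\<in>A. of_bool (Y x = y) * pmf P x)"
    using assms
    by (subst Int_commute) (auto simp: measure_measure_pmf_finite sum.inter_restrict intro!: sum.cong)
  finally show ?thesis .
qed

text \<open>The fibre probability is a product of single-letter probabilities by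
  \<open>sum_words_fibre\<close>, so its exponent is the information sum along the word.\<close>

lemma sum_fibre_eq_info:
  assumes fin: "finite (set_pmf P)" and xs: "xs \<in> words (set_pmf P) n"
  shows "(\<Sum>xs'\<in>words (set_pmf P) n. of_bool (map Y xs = map Y xs') * prod_list (map (pmf P) xs'))
    = 2 powr - sum_list (map (info P Y) xs)"
proof -
  have "(\<Sum>xs'\<in>words (set_pmf P) n. of_bool (map Y xs = map Y xs') * prod_list (map (pmf P) xs'))
      = prod_list (map (\<lambda>x. pmf (map_pmf Y P) (Y x)) xs)"
    using xs sum_words_fibre[of Y "map Y xs" "pmf P" "set_pmf P"]
    by (simp add: words_def eq_commute[of "map Y xs"] pmf_map_eq_sum[OF fin order_refl] comp_def)
  also have "\<dots> = 2 powr - sum_list (map (info P Y) xs)"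
  proof -
    have "set xs \<subseteq> set_pmf P" using xs by (simp add: words_def)
    then show ?thesis
    proof (induction xs)
      case (Cons x xs)
      have "0 < pmf (map_pmf Y P) (Y x)"
        using Cons.prems by (intro pmf_positive) auto
      then have "pmf (map_pmf Y P) (Y x) = 2 powr - info P Y x"
        by (simp add: info_def)
      with Cons show ?case by (simp add: powr_diff powr_minus_divide)
    qed simp
  qed
  finally show ?thesis .
qed

text \<open>Typical words lie in fibres of small probability, so \<open>hash_covers\<close> misses
  few message pairs. A rate may be 0 without strict slack: its message set is then a singleton, and
  every hash term with its factor vanishes, including the joint one.\<close>

lemma broadcast_code_exists:
  fixes P :: "'a pmf" and Y1 :: "'a \<Rightarrow> 'b" and Y2 :: "'a \<Rightarrow> 'c"
    and \<epsilon> :: real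
  assumes fin: "finite (set_pmf P)" and r0: "0 \<le> r1" "0 \<le> r2"
    and r1: "r1 = 0 \<or> r1 < ent P Y1" and r2: "r2 = 0 \<or> r2 < ent P Y2"
    and r12: "r1 = 0 \<or> r2 = 0 \<or> r1 + r2 < ent P (\<lambda>x. (Y1 x, Y2 x))"
    and "0 < \<epsilon>"
  obtains n0 where "\<And>n M1 M2. n0 \<le> n \<Longrightarrow> 0 < M1 \<Longrightarrow> 0 < M2 \<Longrightarrow>
    log 2 (real M1) = real n * r1 \<Longrightarrow> log 2 (real M2) = real n * r2 \<Longrightarrow>
    \<exists>b1 b2. real (card ({..<M1} \<times> {..<M2} - (\<lambda>xs. (b1 (map Y1 xs), b2 (map Y2 xs))) ` words (set_pmf P) n))
      \<le> \<epsilon> * (M1 * M2)"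
proof -
  define A where "A = set_pmf P"
  define Y12 where "Y12 = (\<lambda>x. (Y1 x, Y2 x))"
  note fin = fin[folded A_def]
  \<comment> \<open>Half the smallest positive slack: one \<delta> is spent on typicality, the other
    leaves the decay \<open>2 powr - (real n * \<delta>)\<close>. Nonpositive slacks occur only when
    a rate is 0, and the entry 1 keeps the set nonempty.\<close>
  define \<delta> where "\<delta> = Min ({1} \<union> (\<lambda>t. t / 2) ` {t \<in> {ent P Y1 - r1, ent P Y2 - r2, ent P Y12 - (r1 + r2)}. 0 < t})"
  have \<delta>0: "0 < \<delta>"
    unfolding \<delta>_def by (subst Min_gr_iff) auto
  have \<delta>_le: "\<delta> \<le> t / 2" if "0 < t" "t \<in> {ent P Y1 - r1, ent P Y2 - r2, ent P Y12 - (r1 + r2)}" for t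
    unfolding \<delta>_def using that by (intro Min_le) auto
  define w where "w xs = prod_list (map (pmf P) xs)" for xs
  define V where "V = (\<Sum>x\<in>A. pmf P x * (info P Y1 x - ent P Y1)\<^sup>2)
    + (\<Sum>x\<in>A. pmf P x * (info P Y2 x - ent P Y2)\<^sup>2)
    + (\<Sum>x\<in>A. pmf P x * (info P Y12 x - ent P Y12)\<^sup>2)"
  have "(\<lambda>n. V / (real n * \<delta>\<^sup>2)) \<longlonglongrightarrow> 0"
    using \<delta>0 by real_asymp
  then have ev1: "eventually (\<lambda>n. V / (real n * \<delta>\<^sup>2) < 1 / 2) sequentially"
    by (rule order_tendstoD) simp
  \<comment> \<open>The 6 counts three hash terms, doubled on dividing by a typical mass above
    \<open>1 / 2\<close>.\<close>
  have "(\<lambda>n. 6 * 2 powr - (real n * \<delta>)) \<longlonglongrightarrow> 0"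
    using \<delta>0 by real_asymp
  then have ev2: "eventually (\<lambda>n. 6 * 2 powr - (real n * \<delta>) < \<epsilon>) sequentially"
    using \<open>0 < \<epsilon>\<close> by (rule order_tendstoD)
  obtain n0 where n0: "\<And>n. n0 \<le> n \<Longrightarrow>
      0 < n \<and> V / (real n * \<delta>\<^sup>2) < 1 / 2 \<and> 6 * 2 powr - (real n * \<delta>) < \<epsilon>"
    using eventually_conj[OF eventually_gt_at_top[of 0] eventually_conj[OF ev1 ev2]]
    unfolding eventually_sequentially by blast
  have "\<exists>b1 b2. real (card ({..<M1} \<times> {..<M2} - (\<lambda>xs. (b1 (map Y1 xs), b2 (map Y2 xs))) ` words A n))
      \<le> \<epsilon> * (M1 * M2)"
    if n: "n0 \<le> n" and M: "0 < M1" "0 < M2"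
      and M1: "log 2 (real M1) = real n * r1" and M2: "log 2 (real M2) = real n * r2" for n M1 M2
  proof -
    let ?typ = "\<lambda>H I xs. real n * (H - \<delta>) \<le> sum_list (map I xs)"
    define T where "T = {xs \<in> words A n. ?typ (ent P Y1) (info P Y1) xs
      \<and> ?typ (ent P Y2) (info P Y2) xs \<and> ?typ (ent P Y12) (info P Y12) xs}"
    define c where "c = (\<Sum>xs\<in>T. w xs)"
    have w0: "0 \<le> w xs" for xs
      unfolding w_def by (intro prod_list_nonneg) auto
    have pA: "(\<Sum>x\<in>A. pmf P x) = 1"
      unfolding A_def using fin[unfolded A_def] by (rule sum_pmf_eq_1) simp
    have cheb: "(\<Sum>xs\<in>words A n. of_bool (\<not> ?typ (ent P Y) (info P Y) xs) * w xs)
        \<le> (\<Sum>x\<in>A. pmf P x * (info P Y x - ent P Y)\<^sup>2) / (real n * \<delta>\<^sup>2)" for Y :: "'a \<Rightarrow> 'd"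
      unfolding w_def not_le using fin pA \<delta>0 n0[OF n]
      by (intro chebyshev_words) (auto simp: ent_def A_def)
    have fT: "finite T"
      unfolding T_def using fin by simp
    have "1 = (\<Sum>xs\<in>words A n. w xs)"
      unfolding w_def by (simp add: sum_words_prod_list pA)
    \<comment> \<open>Union bound: a word outside \<open>T\<close> fails at least one of the three
      typicality tests.\<close>
    also have "\<dots> \<le> (\<Sum>xs\<in>words A n. of_bool (xs \<in> T) * w xs
        + (of_bool (\<not> ?typ (ent P Y1) (info P Y1) xs) * w xs
        + of_bool (\<not> ?typ (ent P Y2) (info P Y2) xs) * w xs
        + of_bool (\<not> ?typ (ent P Y12) (info P Y12) xs) * w xs))"
      using w0 by (intro sum_mono) (auto simp: T_def of_bool_def)
    also have "\<dots> \<le> (\<Sum>xs\<in>words A n. of_bool (xs \<in> T) * w xs) + V / (real n * \<delta>\<^sup>2)"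
      unfolding sum.distrib V_def add_divide_distrib
      by (intro add_left_mono add_mono cheb)
    also have "(\<Sum>xs\<in>words A n. of_bool (xs \<in> T) * w xs) = c"
      unfolding c_def using fin by (intro sum.mono_neutral_cong_right) (auto simp: T_def)
    finally have c: "1 / 2 < c"
      using n0[OF n] by linarith
    have fibre: "(\<Sum>xs'\<in>T. of_bool (map Y xs = map Y xs') * w xs') \<le> 2 powr - (real n * (ent P Y - \<delta>))"
      if "xs \<in> T" "?typ (ent P Y) (info P Y) xs" for xs and Y :: "'a \<Rightarrow> 'd"
    proof -
      have "(\<Sum>xs'\<in>T. of_bool (map Y xs = map Y xs') * w xs')
          \<le> (\<Sum>xs'\<in>words A n. of_bool (map Y xs = map Y xs') * w xs')"
        using fin w0 by (intro sum_mono2) (auto simp: T_def)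
      also have "\<dots> = 2 powr - sum_list (map (info P Y) xs)"
        using sum_fibre_eq_info[OF fin[unfolded A_def], of xs n Y] that
        by (simp add: T_def A_def w_def)
      also have "\<dots> \<le> 2 powr - (real n * (ent P Y - \<delta>))"
        using that by (intro powr_mono) auto
      finally show ?thesis .
    qed
    have pair: "map Y1 xs = map Y1 xs' \<and> map Y2 xs = map Y2 xs' \<longleftrightarrow> map Y12 xs = map Y12 xs'" for xs xs'
      by (auto simp: Y12_def list_eq_iff_nth_eq dest: map_eq_imp_length_eq)
    have a: "(\<Sum>xs'\<in>T. of_bool (map Y1 xs = map Y1 xs') * w xs') \<le> 2 powr - (real n * (ent P Y1 - \<delta>))"
      "(\<Sum>xs'\<in>T. of_bool (map Y2 xs = map Y2 xs') * w xs') \<le> 2 powr - (real n * (ent P Y2 - \<delta>))"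
      "(\<Sum>xs'\<in>T. of_bool (map Y1 xs = map Y1 xs' \<and> map Y2 xs = map Y2 xs') * w xs')
        \<le> 2 powr - (real n * (ent P Y12 - \<delta>))"
      if "xs \<in> T" for xs
      using that fibre[of xs Y1] fibre[of xs Y2] fibre[of xs Y12] unfolding pair by (simp_all add: T_def)
    obtain b1 b2 where b: "real (card ({..<M1} \<times> {..<M2} - (\<lambda>xs. (b1 (map Y1 xs), b2 (map Y2 xs))) ` T)) * c
        \<le> M1 * M2 * ((real M1 - 1) * 2 powr - (real n * (ent P Y1 - \<delta>))
          + (real M2 - 1) * 2 powr - (real n * (ent P Y2 - \<delta>))
          + (real M1 - 1) * (real M2 - 1) * 2 powr - (real n * (ent P Y12 - \<delta>)))"
      using hash_covers[OF fT w0 M a c_def] c by fastforce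
    have bound: "m * 2 powr - (real n * (H - \<delta>)) \<le> 2 powr - (real n * \<delta>)"
      if "m \<le> 2 powr (real n * r)" "r + 2 * \<delta> \<le> H" for m r H
    proof -
      have "m * 2 powr - (real n * (H - \<delta>)) \<le> 2 powr (real n * r) * 2 powr - (real n * (H - \<delta>))"
        using that by (intro mult_right_mono) auto
      also have "\<dots> = 2 powr (real n * r - real n * (H - \<delta>))"
        by (simp add: powr_add[symmetric])
      also have "\<dots> \<le> 2 powr - (real n * \<delta>)"
        using mult_left_mono[OF that(2), of "real n"] by (intro powr_mono) (auto simp: algebra_simps)
      finally show ?thesis .
    qed
    have M1': "real M1 = 2 powr (real n * r1)" and M2': "real M2 = 2 powr (real n * r2)"
      using M powr_log_cancel[of 2 "real M1"] powr_log_cancel[of 2 "real M2"]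
      by (simp_all flip: M1 M2)
    have 1: "(real M1 - 1) * 2 powr - (real n * (ent P Y1 - \<delta>)) \<le> 2 powr - (real n * \<delta>)"
    \<comment> \<open>For \<open>r1 = 0\<close> there is one message, and the left side is 0
      whatever the entropy.\<close>
    proof (cases "r1 = 0")
      case False
      with r1 \<delta>_le[of "ent P Y1 - r1"] show ?thesis
        by (intro bound[of _ r1]) (auto simp: M1')
    qed (simp add: M1')
    have 2: "(real M2 - 1) * 2 powr - (real n * (ent P Y2 - \<delta>)) \<le> 2 powr - (real n * \<delta>)"
    proof (cases "r2 = 0")
      case False
      with r2 \<delta>_le[of "ent P Y2 - r2"] show ?thesis
        by (intro bound[of _ r2]) (auto simp: M2')
    qed (simp add: M2')
    have 3: "(real M1 - 1) * (real M2 - 1) * 2 powr - (real n * (ent P Y12 - \<delta>)) \<le> 2 powr - (real n * \<delta>)"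
    proof (cases "r1 = 0 \<or> r2 = 0")
      case False
      have "(real M1 - 1) * (real M2 - 1) \<le> real M1 * real M2"
        using M by (intro mult_mono) auto
      also have "\<dots> = 2 powr (real n * (r1 + r2))"
        by (simp add: M1' M2' powr_add distrib_left)
      finally show ?thesis
        using False r12 \<delta>_le[of "ent P Y12 - (r1 + r2)"]
        by (intro bound[of _ "r1 + r2"]) (auto simp: Y12_def)
    qed (auto simp: M1' M2')
    have mono: "card ({..<M1} \<times> {..<M2} - (\<lambda>xs. (b1 (map Y1 xs), b2 (map Y2 xs))) ` words A n)
        \<le> card ({..<M1} \<times> {..<M2} - (\<lambda>xs. (b1 (map Y1 xs), b2 (map Y2 xs))) ` T)"
      by (intro card_mono Diff_mono image_mono) (auto simp: T_def)
    have "real (card ({..<M1} \<times> {..<M2} - (\<lambda>xs. (b1 (map Y1 xs), b2 (map Y2 xs))) ` words A n)) * (1 / 2)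
        \<le> real (card ({..<M1} \<times> {..<M2} - (\<lambda>xs. (b1 (map Y1 xs), b2 (map Y2 xs))) ` T)) * c"
      using mono c by (intro mult_mono) auto
    also note b
    also have "M1 * M2 * ((real M1 - 1) * 2 powr - (real n * (ent P Y1 - \<delta>))
          + (real M2 - 1) * 2 powr - (real n * (ent P Y2 - \<delta>))
          + (real M1 - 1) * (real M2 - 1) * 2 powr - (real n * (ent P Y12 - \<delta>)))
        \<le> real (M1 * M2) * (\<epsilon> / 2)"
      using 1 2 3 n0[OF n] by (intro mult_left_mono) auto
    finally show ?thesis
      by (intro exI[of _ b1] exI[of _ b2]) (simp add: mult.commute)
  qed
  then show ?thesis
    using that unfolding A_def by blast
qed

section \<open>Achievability\<close>

text \<open>Group the inputs by their value of \<open>Y\<close>. Letting \<open>A\<close> exceed the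
  support gives all laws of a sequence one index set, which \<open>tendsto_ent\<close> relies
  on.\<close>

lemma ent_eq_sum:
  fixes Y :: "'a \<Rightarrow> 'b"
  assumes A: "finite A" "set_pmf P \<subseteq> A"
  shows "ent P Y = - (\<Sum>y\<in>Y ` A. pmf (map_pmf Y P) y * log 2 (pmf (map_pmf Y P) y))"
proof -
  let ?q = "\<lambda>y. pmf (map_pmf Y P) y"
  have "(\<Sum>x\<in>set_pmf P. pmf P x * log 2 (?q (Y x))) = (\<Sum>x\<in>A. pmf P x * log 2 (?q (Y x)))"
    using A by (intro sum.mono_neutral_left) (auto simp: set_pmf_iff)
  also have "\<dots> = (\<Sum>y\<in>Y ` A. \<Sum>x | x \<in> A \<and> Y x = y. pmf P x * log 2 (?q (Y x)))"
    using A(1) by (rule sum.image_gen)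
  also have "\<dots> = (\<Sum>y\<in>Y ` A. ?q y * log 2 (?q y))"
  proof (intro sum.cong refl)
    fix y
    have "?q y = (\<Sum>x | x \<in> A \<and> Y x = y. pmf P x)"
      using A by (simp add: pmf_map_eq_sum[OF A] sum.inter_filter of_bool_def if_distrib if_distribR cong: if_cong)
    then show "(\<Sum>x | x \<in> A \<and> Y x = y. pmf P x * log 2 (?q (Y x))) = ?q y * log 2 (?q y)"
      by (simp add: sum_distrib_right)
  qed
  finally show ?thesis
    by (simp add: ent_def info_def sum_negf)
qed

lemma bit_entropy_eq_ent:
  fixes Y :: "'a \<Rightarrow> 'b::countable"
  assumes "finite (set_pmf P)"
  shows "bit_entropy P Y = ent P Y"
  by (simp add: bit_entropy_eq_sum[OF assms] ent_eq_sum[OF assms order_refl])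

section \<open>Block structure of inputs and outputs\<close>

lemma finite_lists_length [simp]: "finite {xs :: 'x::finite list. length xs = n}"
  using finite_lists_length_eq[of "UNIV :: 'x set" n] by simp

text \<open>Since \<open>xs\<close> fills whole blocks, appended inputs keep their positions modulo
  \<open>L\<close>, and \<open>block_prefix\<close> drops everything before them: there is no memory
  across blocks.\<close>

lemma receive_append_block:
  assumes "length xs = m * L" and "length ys = L"
  shows "receive L f (xs @ ys) = receive L f xs @ receive L f ys"
proof (cases "L = 0")
  case False
  show ?thesis
  proof (rule nth_equalityI)
    fix t assume "t < length (receive L f (xs @ ys))"
    then have t: "t < m * L + L"
      using assms by (simp add: receive_def)
    show "receive L f (xs @ ys) ! t = (receive L f xs @ receive L f ys) ! t"
    proof (cases "t < m * L")
      case True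
      then show ?thesis
        using assms by (simp add: receive_def nth_append block_prefix_def)
    next
      case False
      define i where "i = t - m * L"
      have i: "t = m * L + i" "i < L"
        using False t by (auto simp: i_def)
      show ?thesis
        using assms i by (simp add: receive_def nth_append block_prefix_def)
    qed
  qed (simp add: receive_def)
qed (use assms in \<open>simp add: receive_def\<close>)

lemma length_concat_words: "xss \<in> words {xs. length xs = L} m \<Longrightarrow> length (concat xss) = m * L"
  by (induction m arbitrary: xss) (auto simp: words_def length_Suc_conv)

lemma receive_concat:
  "xss \<in> words {xs. length xs = L} m \<Longrightarrow> receive L f (concat xss) = concat (map (receive L f) xss)"
proof (induction xss arbitrary: m rule: rev_induct)
  case (snoc xs xss)
  then have "xss \<in> words {xs. length xs = L} (m - 1)" "length xs = L"
    by (auto simp: words_def)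
  with snoc.IH[of "m - 1"] show ?case
    by (simp add: receive_append_block[OF length_concat_words])
qed (simp add: receive_def)

lemma length_receive [simp]: "length (receive L f xs) = length xs"
  by (simp add: receive_def)

text \<open>Blocks have equal length and their number is fixed, so a sequence can be cut in only one
  way. The decoders use this to recover the output blocks.\<close>

lemma inj_on_concat_words: "inj_on concat (words {xs. length xs = L} m)"
proof (rule inj_onI)
  fix xss yss :: "'a list list"
  assume w: "xss \<in> words {xs. length xs = L} m" "yss \<in> words {xs. length xs = L} m"
    and eq: "concat xss = concat yss"
  from w have "\<forall>(x, y)\<in>set (zip xss yss). length x = length y"
    by (auto simp: words_def dest: set_zip_leftD set_zip_rightD)
  then show "xss = yss"
    using w eq by (intro concat_injective) (auto simp: words_def)
qed

lemma list_of_blocks: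
  assumes "length xs = m * L"
  obtains xss where "xss \<in> words {xs. length xs = L} m" "concat xss = xs"
proof -
  have "\<exists>xss \<in> words {xs. length xs = L} m. concat xss = xs"
    using assms
  proof (induction m arbitrary: xs)
    case (Suc m)
    have "length (drop L xs) = m * L"
      using Suc.prems by simp
    from Suc.IH[OF this] obtain xss where xss: "xss \<in> words {xs. length xs = L} m" "concat xss = drop L xs"
      by blast
    then show ?case
      using Suc.prems by (intro bexI[of _ "take L xs # xss"]) (auto simp: words_def)
  qed simp
  then show ?thesis
    using that by blast
qed

section \<open>Message pairs and their error probability\<close>

definition msgs :: "nat \<Rightarrow> nat \<Rightarrow> (nat \<times> nat) set" where
  "msgs M1 M2 = {..<M1} \<times> {..<M2}"

lemma msgs_finite [simp]: "finite (msgs M1 M2)"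
  and card_msgs [simp]: "card (msgs M1 M2) = M1 * M2"
  by (simp_all add: msgs_def card_cartesian_product)

text \<open>Independent uniform messages are jointly uniform on \<open>msgs\<close>, which turns
  probabilities over messages into counts. Separating the noise from the message pair allows the
  converse to fix it.\<close>

lemma error_prob_eq:
  assumes "0 < M1" "0 < M2"
  shows "error_prob L f1 f2 N m M1 M2 tx d1 d2 =
    measure_pmf.prob (pair_pmf (pmf_of_set (msgs M1 M2)) (replicate_pmf m N))
      {(w, zs). d1 (receive L f1 (tx (fst w) (snd w) zs)) \<noteq> fst w
        \<or> d2 (receive L f2 (tx (fst w) (snd w) zs)) \<noteq> snd w}"
proof -
  have *: "pmf_of_set (msgs M1 M2) = pair_pmf (pmf_of_set {..<M1}) (pmf_of_set {..<M2})"
  proof (rule pmf_eqI)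
    fix w :: "nat \<times> nat"
    have "{..<M1} \<noteq> {}" "{..<M2} \<noteq> {}" "msgs M1 M2 \<noteq> {}"
      using assms by (auto simp: msgs_def)
    then show "pmf (pmf_of_set (msgs M1 M2)) w = pmf (pair_pmf (pmf_of_set {..<M1}) (pmf_of_set {..<M2})) w"
      by (cases w) (simp add: pmf_pair, simp add: msgs_def indicator_def)
  qed
  show ?thesis
    unfolding error_prob_def * by (auto simp: pair_pair_pmf intro!: arg_cong[where f = "measure_pmf.prob _"])
qed

text \<open>The rates \<open>r1\<close> and \<open>r2\<close> are in bits per block. They are
  rational because \<open>achievable\<close> asks for exact message counts, which here become powers
  of 2.\<close>

lemma achievable_nofb:
  fixes f1 :: "nat \<Rightarrow> 'x::finite list \<Rightarrow> 'y1::finite" and f2 :: "nat \<Rightarrow> 'x list \<Rightarrow> 'y2::finite"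
    and N :: "'z pmf"
  assumes L: "0 < L" and P: "set_pmf P \<subseteq> {xs. length xs = L}"
    and r0: "0 \<le> r1" "0 \<le> r2" and rat: "r1 \<in> \<rat>" "r2 \<in> \<rat>"
    and r: "r1 = 0 \<or> r1 < ent P (receive L f1)" "r2 = 0 \<or> r2 < ent P (receive L f2)"
      "r1 = 0 \<or> r2 = 0 \<or> r1 + r2 < ent P (\<lambda>xs. (receive L f1 xs, receive L f2 xs))"
  shows "achievable L f1 f2 N nofb_transmitters (r1 / L) (r2 / L)"
  unfolding achievable_def
proof (intro allI impI)
  fix \<epsilon> :: real assume \<epsilon>: "0 < \<epsilon>"
  obtain a1 q1 where q1: "q1 \<noteq> 0" "\<bar>r1\<bar> = real a1 / real q1"
    using rat(1) by (rule Rats_abs_nat_div_natE)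
  obtain a2 q2 where q2: "q2 \<noteq> 0" "\<bar>r2\<bar> = real a2 / real q2"
    using rat(2) by (rule Rats_abs_nat_div_natE)
  have finP: "finite (set_pmf P)"
    using P finite_lists_length finite_subset by blast
  obtain n0 where n0: "\<And>n M1 M2. n0 \<le> n \<Longrightarrow> 0 < M1 \<Longrightarrow> 0 < M2 \<Longrightarrow>
      log 2 (real M1) = real n * r1 \<Longrightarrow> log 2 (real M2) = real n * r2 \<Longrightarrow>
      \<exists>b1 b2. real (card ({..<M1} \<times> {..<M2} - (\<lambda>xs. (b1 (map (receive L f1) xs), b2 (map (receive L f2) xs))) ` words (set_pmf P) n))
        \<le> \<epsilon> * (M1 * M2)"
    using broadcast_code_exists[OF finP r0 r \<epsilon>] by blast
  \<comment> \<open>With \<open>r1 = a1 / q1\<close> and \<open>r2 = a2 / q2\<close>, a multiple of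
    \<open>q1 * q2\<close> makes \<open>m * r1\<close> and \<open>m * r2\<close> integers;
    \<open>Suc n0\<close> makes it large enough.\<close>
  define m where "m = q1 * q2 * Suc n0"
  define M1 :: nat where "M1 = 2 ^ (a1 * q2 * Suc n0)"
  define M2 :: nat where "M2 = 2 ^ (a2 * q1 * Suc n0)"
  have m: "n0 \<le> m" "0 < m"
    using q1 q2 mult_le_mono[of 1 "q1 * q2" n0 "Suc n0"] by (auto simp: m_def)
  have M: "0 < M1" "0 < M2"
    by (auto simp: M1_def M2_def)
  have "log 2 (real M1) = real (a1 * q2 * Suc n0)" "log 2 (real M2) = real (a2 * q1 * Suc n0)"
    unfolding M1_def M2_def of_nat_power of_nat_numeral by (rule log_pow_cancel; simp)+
  moreover have "r1 = real a1 / real q1" "r2 = real a2 / real q2"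
    using q1 q2 r0 by simp_all
  ultimately have lM: "log 2 (real M1) = real m * r1" "log 2 (real M2) = real m * r2"
    using q1(1) q2(1) by (simp_all add: m_def del: of_nat_Suc mult_Suc_right)
  obtain b1 b2 where
    b: "real (card (msgs M1 M2 - (\<lambda>xs. (b1 (map (receive L f1) xs), b2 (map (receive L f2) xs))) ` words (set_pmf P) m))
        \<le> \<epsilon> * (M1 * M2)"
    using n0[OF m(1) M lM, folded msgs_def] by (elim exE) (rule that)
  define W where "W = words {xs :: 'x list. length xs = L} m"
  have sub: "words (set_pmf P) m \<subseteq> W"
    using P by (auto simp: W_def words_def)
  define covered where "covered = (\<lambda>xs. (b1 (map (receive L f1) xs), b2 (map (receive L f2) xs))) ` words (set_pmf P) m"
  \<comment> \<open>Each covered pair gets a codeword with the two right hash values; any other pair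
    gets an arbitrary one and is charged as an error.\<close>
  have "\<forall>w. \<exists>xss. w \<in> covered \<longrightarrow> xss \<in> W \<and> b1 (map (receive L f1) xss) = fst w \<and> b2 (map (receive L f2) xss) = snd w"
    using sub unfolding covered_def by (auto simp: image_iff)
  from choice[OF this] obtain code where code: "\<And>w. w \<in> covered \<Longrightarrow> code w \<in> W \<and>
      b1 (map (receive L f1) (code w)) = fst w \<and> b2 (map (receive L f2) (code w)) = snd w"
    by blast
  define tx where "tx = (\<lambda>w1 w2 (zs :: 'z list). map (\<lambda>t. concat (code (w1, w2)) ! t) [0..<m * L])"
  \<comment> \<open>Decoding cuts the received sequence into blocks and hashes the resulting output
    word.\<close>
  define d1 where "d1 ys = b1 (inv_into (words {ys. length ys = L} m) concat ys)" for ys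
  define d2 where "d2 ys = b2 (inv_into (words {ys. length ys = L} m) concat ys)" for ys
  have tx: "tx w1 w2 zs = concat (code (w1, w2))" if "(w1, w2) \<in> covered" for w1 w2 zs
    using length_concat_words[of "code (w1, w2)" L m] code[OF that] map_nth[of "concat (code (w1, w2))"]
    by (simp add: tx_def W_def)
  have ok: "inv_into (words {ys. length ys = L} m) concat (receive L f (tx w1 w2 zs))
      = map (receive L f) (code (w1, w2))"
    if w: "(w1, w2) \<in> covered" for w1 w2 zs and f :: "nat \<Rightarrow> 'x list \<Rightarrow> 'd"
  proof -
    have c: "code (w1, w2) \<in> words {xs. length xs = L} m"
      using code[OF w] by (simp add: W_def)
    then have "map (receive L f) (code (w1, w2)) \<in> words {ys. length ys = L} m"
      by (auto simp: words_def)
    then show ?thesis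
      unfolding tx[OF w] receive_concat[OF c] by (intro inv_into_f_f inj_on_concat_words)
  qed
  have "error_prob L f1 f2 N m M1 M2 tx d1 d2
      \<le> measure_pmf.prob (pair_pmf (pmf_of_set (msgs M1 M2)) (replicate_pmf m N)) (fst -` (- covered))"
    unfolding error_prob_eq[OF M]
    using code by (intro measure_pmf.finite_measure_mono) (auto simp: d1_def d2_def ok)
  also have "\<dots> = measure_pmf.prob (map_pmf fst (pair_pmf (pmf_of_set (msgs M1 M2)) (replicate_pmf m N))) (- covered)"
    by simp
  also have "\<dots> = real (card (msgs M1 M2 \<inter> - covered)) / real (card (msgs M1 M2))"
    unfolding map_fst_pair_pmf using M by (intro measure_pmf_of_set) (auto simp: msgs_def)
  also have "\<dots> \<le> \<epsilon>"
    using b M by (simp add: Diff_eq covered_def[symmetric] divide_le_eq)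
  finally have "error_prob L f1 f2 N m M1 M2 tx d1 d2 \<le> \<epsilon>" .
  moreover have "tx \<in> nofb_transmitters (m * L)"
    unfolding nofb_transmitters_def mem_Collect_eq
    by (rule exI[of _ "\<lambda>w1 w2 t. concat (code (w1, w2)) ! t"]) (simp add: tx_def)
  ultimately show "\<exists>m M1 M2. 0 < m \<and> 0 < M1 \<and> 0 < M2 \<and>
      log 2 (real M1) = real (m * L) * (r1 / L) \<and> log 2 (real M2) = real (m * L) * (r2 / L) \<and>
      (\<exists>tx\<in>nofb_transmitters (m * L). \<exists>d1 d2. error_prob L f1 f2 N m M1 M2 tx d1 d2 \<le> \<epsilon>)"
    using m M lM L by (intro exI[of _ m] exI[of _ M1] exI[of _ M2]) auto
qed

section \<open>Approximation of rate points by rational ones\<close>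

text \<open>A zero rate stays zero, as no nonnegative rate lies strictly below it; this matches the
  alternatives allowed in \<open>achievable_nofb\<close>.\<close>

lemma rational_below:
  fixes r :: real
  assumes "0 \<le> r" "0 < e"
  obtains r' where "r' \<in> \<rat>" "0 \<le> r'" "r' = 0 \<or> r' < r" "r' \<le> r" "r - e < r'"
proof (cases "r = 0")
  case True
  then show ?thesis
    using assms by (intro that[of 0]) auto
next
  case False
  then obtain q where "q \<in> \<rat>" "max 0 (r - e) < q" "q < r"
    using assms Rats_dense_in_real[of "max 0 (r - e)" r] by auto
  then show ?thesis
    by (intro that[of q]) auto
qed

text \<open>Rational rates slightly below a given point meet the strict conditions: if both are
  nonzero, each lies strictly below its target, hence so does their sum. The closure supplies the
  point itself.\<close>

lemma rate_region_subset_nofb: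
  fixes f1 :: "nat \<Rightarrow> 'x::finite list \<Rightarrow> 'y1::finite" and f2 :: "nat \<Rightarrow> 'x list \<Rightarrow> 'y2::finite"
  assumes L: "0 < L" and P: "set_pmf P \<subseteq> {xs. length xs = L}"
  shows "rate_region L f1 f2 P \<subseteq> capacity_region_nofb L f1 f2 N"
proof safe
  fix R1 R2 assume "(R1, R2) \<in> rate_region L f1 f2 P"
  moreover have "finite (set_pmf P)"
    using P finite_lists_length finite_subset by blast
  ultimately have R: "0 \<le> L * R1" "0 \<le> L * R2" "L * R1 \<le> ent P (receive L f1)" "L * R2 \<le> ent P (receive L f2)"
    "L * R1 + L * R2 \<le> ent P (\<lambda>xs. (receive L f1 xs, receive L f2 xs))"
    using L by (auto simp: rate_region_def bit_entropy_eq_ent field_simps)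
  show "(R1, R2) \<in> capacity_region_nofb L f1 f2 N"
    unfolding capacity_region_nofb_def closure_approachable
  proof (intro allI impI)
    fix e :: real assume "0 < e"
    \<comment> \<open>The approximants are per block; dividing by \<open>L\<close> leaves an error
      below \<open>e / 2\<close> in each coordinate.\<close>
    then have e: "0 < L * e / 2"
      using L by simp
    obtain r1 where r1: "r1 \<in> \<rat>" "0 \<le> r1" "r1 = 0 \<or> r1 < L * R1" "r1 \<le> L * R1" "L * R1 - L * e / 2 < r1"
      by (rule rational_below[OF R(1) e])
    obtain r2 where r2: "r2 \<in> \<rat>" "0 \<le> r2" "r2 = 0 \<or> r2 < L * R2" "r2 \<le> L * R2" "L * R2 - L * e / 2 < r2"
      by (rule rational_below[OF R(2) e])
    have "achievable L f1 f2 N nofb_transmitters (r1 / L) (r2 / L)"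
      using r1 r2 R by (intro achievable_nofb[OF L P]) auto
    moreover have "dist (r1 / L, r2 / L) (R1, R2) < e"
    proof -
      have "\<bar>r1 / L - R1\<bar> < e / 2" "\<bar>r2 / L - R2\<bar> < e / 2"
        using r1 r2 L by (auto simp: abs_less_iff field_simps)
      then have "\<bar>r1 / L - R1\<bar> + \<bar>r2 / L - R2\<bar> < e"
        by simp
      moreover have "dist (r1 / L, r2 / L) (R1, R2) \<le> \<bar>r1 / L - R1\<bar> + \<bar>r2 / L - R2\<bar>"
        unfolding dist_Pair_Pair dist_real_def using sqrt_sum_squares_le_sum_abs by simp
      ultimately show ?thesis by linarith
    qed
    ultimately show "\<exists>y\<in>{(R1, R2). achievable L f1 f2 N nofb_transmitters R1 R2}. dist y (R1, R2) < e"
      by blast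
  qed
qed

section \<open>Open-loop encoders as feedback encoders\<close>

text \<open>An encoder that reads only the number of past feedback outputs sees only the time. The
  length claim belongs to the same induction because it identifies that number with the
  time.\<close>

lemma fb_run_open_loop:
  "length (snd (fb_run L fb (\<lambda>ys. g (length ys)) zs n)) = n \<and>
   fst (fb_run L fb (\<lambda>ys. g (length ys)) zs n) = map g [0..<n]"
  by (induction n) (auto simp: case_prod_unfold Let_def)

lemma nofb_transmitters_subset:
  fixes fb :: "nat \<Rightarrow> 'x list \<Rightarrow> 'z \<Rightarrow> 'f"
  shows "nofb_transmitters n \<subseteq> fb_transmitters L fb n"
proof
  fix tx :: "nat \<Rightarrow> nat \<Rightarrow> 'z list \<Rightarrow> 'x list"
  assume "tx \<in> nofb_transmitters n"
  then obtain enc where "tx = (\<lambda>w1 w2 zs. map (enc w1 w2) [0..<n])"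
    by (auto simp: nofb_transmitters_def)
  then have "tx = (\<lambda>w1 w2 zs. fst (fb_run L fb ((\<lambda>w1 w2 ys. enc w1 w2 (length ys)) w1 w2) zs n))"
    by (simp add: fb_run_open_loop)
  then show "tx \<in> fb_transmitters L fb n"
    unfolding fb_transmitters_def mem_Collect_eq by (intro exI conjI TrueI)
qed

lemma length_fb_transmitters:
  assumes "tx \<in> fb_transmitters L fb n"
  shows "length (tx w1 w2 zs) = n"
proof -
  have "length (fst (fb_run L fb g zs n)) = n" for g
    by (induction n) (auto simp: case_prod_unfold Let_def)
  with assms show ?thesis
    by (auto simp: fb_transmitters_def)
qed

lemma achievable_mono:
  assumes T: "\<And>n. T n \<subseteq> T' n" and "achievable L f1 f2 N T R1 R2"
  shows "achievable L f1 f2 N T' R1 R2"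
  unfolding achievable_def
proof (intro allI impI)
  fix \<epsilon> :: real assume "0 < \<epsilon>"
  with assms(2) obtain m M1 M2 where m: "0 < m \<and> 0 < M1 \<and> 0 < M2 \<and>
      log 2 (real M1) = real (m * L) * R1 \<and> log 2 (real M2) = real (m * L) * R2"
    and tx: "\<exists>tx\<in>T (m * L). \<exists>d1 d2. error_prob L f1 f2 N m M1 M2 tx d1 d2 \<le> \<epsilon>"
    unfolding achievable_def by meson
  from tx have "\<exists>tx\<in>T' (m * L). \<exists>d1 d2. error_prob L f1 f2 N m M1 M2 tx d1 d2 \<le> \<epsilon>"
    by (rule bexE) (rule bexI[OF _ subsetD[OF T]])
  with m show "\<exists>m M1 M2. 0 < m \<and> 0 < M1 \<and> 0 < M2 \<and>
      log 2 (real M1) = real (m * L) * R1 \<and> log 2 (real M2) = real (m * L) * R2 \<and>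
      (\<exists>tx\<in>T' (m * L). \<exists>d1 d2. error_prob L f1 f2 N m M1 M2 tx d1 d2 \<le> \<epsilon>)"
    by (intro exI[of _ m] exI[of _ M1] exI[of _ M2]) simp
qed

lemma nofb_subset_fb:
  fixes f1 :: "nat \<Rightarrow> 'x list \<Rightarrow> 'y1" and fb :: "nat \<Rightarrow> 'x list \<Rightarrow> 'z \<Rightarrow> 'f"
  shows "capacity_region_nofb L f1 f2 N \<subseteq> capacity_region_fb L f1 f2 fb N"
  unfolding capacity_region_nofb_def capacity_region_fb_def
  by (intro closure_mono subsetI, clarify) (rule achievable_mono[OF nofb_transmitters_subset])

section \<open>Converse\<close>

lemma ent_map_pmf_of_set:
  assumes "finite S" "S \<noteq> {}"
  shows "ent (map_pmf h (pmf_of_set S)) Y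
    = (\<Sum>s\<in>S. info (map_pmf h (pmf_of_set S)) Y (h s)) / card S"
proof -
  let ?P = "map_pmf h (pmf_of_set S)"
  have "ent ?P Y = measure_pmf.expectation ?P (info ?P Y)"
    unfolding ent_def using assms by (subst integral_measure_pmf_real[of "set_pmf ?P"]) (auto simp: mult.commute)
  then show ?thesis
    using assms by (simp add: integral_pmf_of_set)
qed

text \<open>Gibbs' inequality against the product of the averaged single-block law yields
  subadditivity and concavity of entropy in one step.\<close>

lemma log_card_le_block_entropy:
  fixes \<xi> :: "'g \<Rightarrow> 'a list" and Y :: "'a \<Rightarrow> 'b"
  assumes G: "finite G" "G \<noteq> {}" and m: "0 < m" and len: "\<And>g. g \<in> G \<Longrightarrow> length (\<xi> g) = m"
    and K: "0 < K" "\<And>g. g \<in> G \<Longrightarrow> card {g' \<in> G. map Y (\<xi> g') = map Y (\<xi> g)} \<le> K"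
    and P: "P = map_pmf (\<lambda>(g, b). \<xi> g ! b) (pmf_of_set (G \<times> {..<m}))"
  shows "log 2 (real (card G) / K) \<le> real m * ent P Y"
proof -
  define q where "q = pmf (map_pmf Y P)"
  \<comment> \<open>The probability of the output word of \<open>g\<close> if its blocks were drawn
    independently from the averaged law \<open>P\<close>.\<close>
  define s where "s g = prod_list (map q (map Y (\<xi> g)))" for g
  have GM: "finite (G \<times> {..<m})" "G \<times> {..<m} \<noteq> {}" "0 < card G"
    using G m by (auto simp: card_gt_0_iff)
  have setP: "set_pmf P = (\<lambda>(g, b). \<xi> g ! b) ` (G \<times> {..<m})"
    unfolding P using GM by simp
  have q0: "0 < q (Y x)" if "x \<in> set_pmf P" for x
    unfolding q_def using that by (intro pmf_positive) auto
  have in_P: "\<xi> g ! b \<in> set_pmf P" if "g \<in> G" "b < m" for g b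
    unfolding setP using that by force
  have s_eq: "s g = (\<Prod>b<m. q (Y (\<xi> g ! b)))" if "g \<in> G" for g
    unfolding s_def using len[OF that] by (simp add: prod.list_conv_set_nth atLeast0LessThan comp_def)
  have s0: "0 < s g" if "g \<in> G" for g
    unfolding s_eq[OF that] using that in_P q0 by (intro prod_pos) auto
  have ln_s: "ln (s g) = - ln 2 * (\<Sum>b<m. info P Y (\<xi> g ! b))" if "g \<in> G" for g
  proof -
    have "ln (s g) = (\<Sum>b<m. ln (q (Y (\<xi> g ! b))))"
      unfolding s_eq[OF that] using that in_P q0 by (intro ln_prod) force+
    also have "\<dots> = - ln 2 * (\<Sum>b<m. info P Y (\<xi> g ! b))"
      by (simp add: info_def q_def log_def sum_distrib_left sum_negf)
    finally show ?thesis .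
  qed
  define B where "B = Y ` set_pmf P"
  have finB: "finite B"
    unfolding B_def setP using GM by simp
  have img: "(\<lambda>g. map Y (\<xi> g)) ` G \<subseteq> words B m"
    using len in_P by (auto simp: words_def B_def in_set_conv_nth)
  \<comment> \<open>Each output word comes from at most \<open>K\<close> elements of
    \<open>G\<close>, and the product law has total mass 1, so the sum is at most
    \<open>K\<close>.\<close>
  have "(\<Sum>g\<in>G. s g) = (\<Sum>ys\<in>(\<lambda>g. map Y (\<xi> g)) ` G. \<Sum>g | g \<in> G \<and> map Y (\<xi> g) = ys. s g)"
    using G(1) by (rule sum.image_gen)
  also have "\<dots> \<le> (\<Sum>ys\<in>(\<lambda>g. map Y (\<xi> g)) ` G. real K * prod_list (map q ys))"
  proof (rule sum_mono)
    fix ys assume "ys \<in> (\<lambda>g. map Y (\<xi> g)) ` G"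
    then obtain g where g: "g \<in> G" "ys = map Y (\<xi> g)" by blast
    have "(\<Sum>g | g \<in> G \<and> map Y (\<xi> g) = ys. s g)
        = real (card {g' \<in> G. map Y (\<xi> g') = map Y (\<xi> g)}) * prod_list (map q ys)"
      by (simp add: s_def g)
    also have "\<dots> \<le> real K * prod_list (map q ys)"
      using K(2)[OF g(1)] by (intro mult_right_mono prod_list_nonneg) (auto simp: q_def)
    finally show "(\<Sum>g | g \<in> G \<and> map Y (\<xi> g) = ys. s g) \<le> real K * prod_list (map q ys)" .
  qed
  also have "\<dots> \<le> (\<Sum>ys\<in>words B m. real K * prod_list (map q ys))"
    using img finB by (intro sum_mono2 mult_nonneg_nonneg prod_list_nonneg) (auto simp: q_def)
  also have "\<dots> = real K"
  proof -
    have "sum q B = 1"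
      unfolding q_def using finB by (intro sum_pmf_eq_1) (auto simp: B_def)
    then show ?thesis
      by (simp add: sum_words_prod_list flip: sum_distrib_left)
  qed
  finally have sum_s: "(\<Sum>g\<in>G. s g) \<le> real K" .
  define c where "c = real (card G) / K"
  have c0: "0 < c" using GM K(1) by (simp add: c_def)
  \<comment> \<open>Gibbs' inequality from \<open>ln t \<le> t - 1\<close> at
    \<open>t = s g * c\<close>; \<open>c\<close> is chosen so that these values of \<open>t\<close>
    sum to at most \<open>card G\<close>.\<close>
  have "(\<Sum>g\<in>G. ln (s g) + ln c) \<le> (\<Sum>g\<in>G. s g * c - 1)"
    using s0 c0 by (intro sum_mono) (auto simp flip: ln_mult_pos intro!: ln_le_minus_one)
  also have "\<dots> = (\<Sum>g\<in>G. s g) * c - card G"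
    by (simp add: sum_subtractf sum_distrib_right)
  also have "\<dots> \<le> real K * c - card G"
    using sum_s c0 by (intro diff_right_mono mult_right_mono) auto
  also have "\<dots> = 0"
    using K(1) by (simp add: c_def)
  finally have "real (card G) * ln c \<le> ln 2 * (\<Sum>g\<in>G. \<Sum>b<m. info P Y (\<xi> g ! b))"
    unfolding sum.distrib by (simp add: ln_s sum_negf flip: sum_distrib_left)
  \<comment> \<open>\<open>P\<close> is the law of a uniformly chosen block of a uniformly chosen
    word, so the double sum is a multiple of the mean information.\<close>
  also have "(\<Sum>g\<in>G. \<Sum>b<m. info P Y (\<xi> g ! b)) = real (card G) * (real m * ent P Y)"
    using ent_map_pmf_of_set[OF GM(1,2), of "\<lambda>(g, b). \<xi> g ! b" Y, folded P] GM m
    by (simp add: case_prod_unfold sum.cartesian_product card_cartesian_product)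
  finally have "real (card G) * ln c \<le> real (card G) * (ln 2 * (real m * ent P Y))"
    by (simp only: mult.left_commute)
  then show ?thesis
    using GM(3) by (simp add: log_def c_def divide_le_eq mult_ac)
qed

text \<open>The error probability is the mean over \<open>z\<close> of the fraction of failing
  \<open>w\<close>, so some \<open>z\<close> does no worse than the mean.\<close>

lemma exists_good_noise:
  fixes Q :: "'z pmf" and S :: "'w set"
  assumes S: "finite S" "S \<noteq> {}" and le: "measure_pmf.prob (pair_pmf (pmf_of_set S) Q) E \<le> \<epsilon>"
  obtains z where "real (card {w \<in> S. (w, z) \<in> E}) \<le> \<epsilon> * card S"
proof -
  define h where "h z = real (card {w \<in> S. (w, z) \<in> E}) / card S" for z
  have h: "measure_pmf.prob (map_pmf (\<lambda>w. (w, z)) (pmf_of_set S)) E = h z" for z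
    unfolding h_def using S by (simp add: measure_pmf_of_set Int_def)
  have h01: "0 \<le> h z" "h z \<le> 1" for z
    unfolding h[symmetric] by simp_all
  have int: "integrable (measure_pmf Q) h"
    using h01 by (intro measure_pmf.integrable_const_bound[where B = 1]) auto
  have "pair_pmf (pmf_of_set S) Q = bind_pmf Q (\<lambda>z. map_pmf (\<lambda>w. (w, z)) (pmf_of_set S))"
    by (subst pair_commute_pmf) (simp add: pair_pmf_def map_bind_pmf map_pmf_def bind_assoc_pmf bind_return_pmf)
  then have "emeasure (measure_pmf (pair_pmf (pmf_of_set S) Q)) E
      = (\<integral>\<^sup>+z. emeasure (map_pmf (\<lambda>w. (w, z)) (pmf_of_set S)) E \<partial>Q)"
    by (simp only: emeasure_bind_pmf)
  also have "\<dots> = (\<integral>\<^sup>+z. ennreal (h z) \<partial>Q)"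
    by (simp only: measure_pmf.emeasure_eq_measure h)
  also have "\<dots> = ennreal (\<integral>z. h z \<partial>Q)"
    using int h01 by (intro nn_integral_eq_integral) auto
  finally have "(\<integral>z. h z \<partial>Q) \<le> \<epsilon>"
    using le h01 by (simp add: measure_pmf.emeasure_eq_measure integral_nonneg_AE)
  then have "\<not> (\<forall>z. \<epsilon> < h z)"
    using measure_pmf.expectation_greater[OF int, of \<epsilon>] by auto
  then obtain z where "h z \<le> \<epsilon>"
    by (auto simp: not_less)
  then show ?thesis
    using S by (intro that[of z]) (simp add: h_def divide_le_eq card_gt_0_iff)
qed

text \<open>The argument asks of a transmitter only that its words have the right length. One law
  \<open>P\<close>, averaged over correctly decoded pairs and block positions, serves all three
  bounds.\<close>

lemma near_rate_region:
  fixes f1 :: "nat \<Rightarrow> 'x list \<Rightarrow> 'y1" and f2 :: "nat \<Rightarrow> 'x list \<Rightarrow> 'y2" and N :: "'z pmf"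
  assumes L: "0 < L" and T: "\<And>n tx w1 w2 zs. tx \<in> T n \<Longrightarrow> length (tx w1 w2 zs) = n"
    and ach: "achievable L f1 f2 N T R1 R2" and \<delta>: "0 < \<delta>"
  obtains P where "set_pmf P \<subseteq> {xs. length xs = L}" "0 \<le> R1" "0 \<le> R2"
    "L * R1 \<le> ent P (receive L f1) + \<delta>" "L * R2 \<le> ent P (receive L f2) + \<delta>"
    "L * (R1 + R2) \<le> ent P (\<lambda>xs. (receive L f1 xs, receive L f2 xs)) + \<delta>"
proof -
  \<comment> \<open>At this error level at least a fraction \<open>2 powr - \<delta>\<close> of the
    message pairs is decoded correctly, which costs at most \<delta> bits.\<close>
  have "0 < 1 - 2 powr - \<delta>"
    using \<delta> powr_less_mono[of "- \<delta>" 0 2] by simp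
  with ach obtain m M1 M2 tx d1 d2 where m: "0 < m" and M: "0 < M1" "0 < M2"
    and lM: "log 2 (real M1) = real (m * L) * R1" "log 2 (real M2) = real (m * L) * R2"
    and tx: "tx \<in> T (m * L)" and err: "error_prob L f1 f2 N m M1 M2 tx d1 d2 \<le> 1 - 2 powr - \<delta>"
    unfolding achievable_def by meson
  define E where "E = {(w, zs). d1 (receive L f1 (tx (fst w) (snd w) zs)) \<noteq> fst w
        \<or> d2 (receive L f2 (tx (fst w) (snd w) zs)) \<noteq> snd w}"
  have ne: "msgs M1 M2 \<noteq> {}"
    using M by (auto simp: msgs_def)
  obtain z where z: "real (card {w \<in> msgs M1 M2. (w, z) \<in> E}) \<le> (1 - 2 powr - \<delta>) * card (msgs M1 M2)"
    using exists_good_noise[OF msgs_finite ne err[unfolded error_prob_eq[OF M], folded E_def]] .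
  define G where "G = {w \<in> msgs M1 M2. (w, z) \<notin> E}"
  have "msgs M1 M2 = G \<union> {w \<in> msgs M1 M2. (w, z) \<in> E}"
    by (auto simp: G_def)
  then have "card (msgs M1 M2) = card G + card {w \<in> msgs M1 M2. (w, z) \<in> E}"
    using card_Un_disjoint[of G "{w \<in> msgs M1 M2. (w, z) \<in> E}"] by (simp add: G_def disjoint_iff)
  from arg_cong[OF this, of real]
  have "real (card G) + real (card {w \<in> msgs M1 M2. (w, z) \<in> E}) = real M1 * real M2"
    by simp
  with z have cG: "2 powr - \<delta> * (real M1 * real M2) \<le> real (card G)"
    by (simp add: left_diff_distrib)
  moreover have "0 < 2 powr - \<delta> * (real M1 * real M2)"
    using M by simp
  ultimately have "0 < card G"
    by linarith
  then have G: "finite G" "G \<noteq> {}"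
    by (simp_all add: card_gt_0_iff)
  have "\<forall>w. \<exists>xss. xss \<in> words {xs. length xs = L} m \<and> concat xss = tx (fst w) (snd w) z"
    using list_of_blocks[OF T[OF tx]] by blast
  from choice[OF this] obtain \<xi> where \<xi>: "\<And>w. \<xi> w \<in> words {xs. length xs = L} m" "\<And>w. concat (\<xi> w) = tx (fst w) (snd w) z"
    by blast
  have len: "length (\<xi> w) = m" for w
    using \<xi>(1)[of w] by (simp add: words_def)
  have rec: "receive L f (tx (fst w) (snd w) z) = concat (map (receive L f) (\<xi> w))"
    for w and f :: "nat \<Rightarrow> 'x list \<Rightarrow> 'd"
    unfolding \<xi>(2)[symmetric] by (rule receive_concat[OF \<xi>(1)])
  have dec: "d1 (concat (map (receive L f1) (\<xi> w))) = fst w" "d2 (concat (map (receive L f2) (\<xi> w))) = snd w"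
    if "w \<in> G" for w
    using that by (auto simp: G_def E_def rec)
  define P where "P = map_pmf (\<lambda>(g, b). \<xi> g ! b) (pmf_of_set (G \<times> {..<m}))"
  have "G \<times> {..<m} \<noteq> {}"
    using G m by auto
  then have "set_pmf P = (\<lambda>(g, b). \<xi> g ! b) ` (G \<times> {..<m})"
    unfolding P_def using G by simp
  then have P: "set_pmf P \<subseteq> {xs. length xs = L}"
    using \<xi>(1) by (force simp: words_def set_conv_nth)
  have GM: "G \<subseteq> {..<M1} \<times> {..<M2}"
    by (auto simp: G_def msgs_def)
  \<comment> \<open>\<open>M\<close> is the number of message values that the output distinguishes,
    and \<open>K\<close> the number left open by it: \<open>(M1, M2)\<close>,
    \<open>(M2, M1)\<close> and \<open>(M1 * M2, 1)\<close> are the three instances of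
    \<open>(M, K)\<close>.\<close>
  have bound: "real L * r \<le> ent P Y + \<delta>"
    if K: "0 < K" "\<And>g. g \<in> G \<Longrightarrow> card {g' \<in> G. map Y (\<xi> g') = map Y (\<xi> g)} \<le> K"
      and r: "log 2 M = real (m * L) * r" "0 < M" and le: "M * K \<le> real M1 * real M2"
    for Y :: "'x list \<Rightarrow> 'd" and K :: nat and M r :: real
  proof -
    have "real (m * L) * r - \<delta> = log 2 (2 powr - \<delta> * M)"
      using r by (simp add: log_mult)
    also have "\<dots> \<le> log 2 (real (card G) / K)"
    proof -
      have "2 powr - \<delta> * M * K \<le> real (card G)"
        using order_trans[OF mult_left_mono[OF le, of "2 powr - \<delta>"] cG] by (simp add: mult.assoc)
      then show ?thesis
        using K(1) r by (intro log_mono) (auto simp: pos_le_divide_eq)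
    qed
    also have "\<dots> \<le> real m * ent P Y"
      using G m len K P_def by (rule log_card_le_block_entropy)
    finally have "real m * (real L * r - ent P Y) \<le> \<delta>"
      by (simp add: algebra_simps)
    \<comment> \<open>The loss is incurred once for all \<open>m\<close> blocks, so it is at most
      \<delta> per block.\<close>
    also have "\<delta> \<le> real m * \<delta>"
      using m \<delta> by simp
    finally show ?thesis
      using m by simp
  qed
  have "real L * R1 \<le> ent P (receive L f1) + \<delta>"
  proof (rule bound[of M2 _ "real M1"])
    fix g assume g: "g \<in> G"
    \<comment> \<open>Correct decoding recovers the first message from this output word, so only the
      second message can vary.\<close>
    have "fst g' = fst g \<and> snd g' < M2"
      if "g' \<in> G" "map (receive L f1) (\<xi> g') = map (receive L f1) (\<xi> g)" for g'
      using dec(1)[OF g] dec(1)[OF that(1)] that subsetD[OF GM that(1)] by (simp add: mem_Times_iff)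
    then have "{g' \<in> G. map (receive L f1) (\<xi> g') = map (receive L f1) (\<xi> g)} \<subseteq> {fst g} \<times> {..<M2}"
      by (simp add: subset_iff mem_Times_iff)
    from card_mono[OF _ this]
    show "card {g' \<in> G. map (receive L f1) (\<xi> g') = map (receive L f1) (\<xi> g)} \<le> M2"
      by simp
  qed (use M lM in auto)
  moreover have "real L * R2 \<le> ent P (receive L f2) + \<delta>"
  proof (rule bound[of M1 _ "real M2"])
    fix g assume g: "g \<in> G"
    have "snd g' = snd g \<and> fst g' < M1"
      if "g' \<in> G" "map (receive L f2) (\<xi> g') = map (receive L f2) (\<xi> g)" for g'
      using dec(2)[OF g] dec(2)[OF that(1)] that subsetD[OF GM that(1)] by (simp add: mem_Times_iff)
    then have "{g' \<in> G. map (receive L f2) (\<xi> g') = map (receive L f2) (\<xi> g)} \<subseteq> {..<M1} \<times> {snd g}"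
      by (simp add: subset_iff mem_Times_iff)
    from card_mono[OF _ this]
    show "card {g' \<in> G. map (receive L f2) (\<xi> g') = map (receive L f2) (\<xi> g)} \<le> M1"
      by simp
  qed (use M lM in auto)
  moreover have "real L * (R1 + R2) \<le> ent P (\<lambda>xs. (receive L f1 xs, receive L f2 xs)) + \<delta>"
  proof (rule bound[of 1 _ "real M1 * real M2"])
    fix g assume g: "g \<in> G"
    have "g' = g" if g': "g' \<in> G"
      and eq: "map (\<lambda>xs. (receive L f1 xs, receive L f2 xs)) (\<xi> g') = map (\<lambda>xs. (receive L f1 xs, receive L f2 xs)) (\<xi> g)" for g'
    proof -
      have "map (receive L f1) (\<xi> g') = map (receive L f1) (\<xi> g)" "map (receive L f2) (\<xi> g') = map (receive L f2) (\<xi> g)"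
        using arg_cong[OF eq, of "map fst"] arg_cong[OF eq, of "map snd"] by (simp_all add: comp_def)
      then show ?thesis
        using dec[OF g] dec[OF g'] by (simp add: prod_eq_iff)
    qed
    then have "{g' \<in> G. map (\<lambda>xs. (receive L f1 xs, receive L f2 xs)) (\<xi> g') = map (\<lambda>xs. (receive L f1 xs, receive L f2 xs)) (\<xi> g)} \<subseteq> {g}"
      by blast
    from card_mono[OF _ this]
    show "card {g' \<in> G. map (\<lambda>xs. (receive L f1 xs, receive L f2 xs)) (\<xi> g') = map (\<lambda>xs. (receive L f1 xs, receive L f2 xs)) (\<xi> g)} \<le> 1"
      by simp
  qed (use M lM in \<open>auto simp: log_mult algebra_simps\<close>)
  moreover have "0 \<le> R1" "0 \<le> R2"
  proof -
    have "0 \<le> real (m * L) * R1" "0 \<le> real (m * L) * R2"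
      unfolding lM[symmetric] using M by simp_all
    then show "0 \<le> R1" "0 \<le> R2"
      using m L by (simp_all add: zero_le_mult_iff mult_le_0_iff)
  qed
  ultimately show ?thesis
    using that P by blast
qed

section \<open>Compactness of the block laws and continuity of entropy\<close>

text \<open>Bolzano-Weierstrass one coordinate at a time: a further subsequence keeps the limits
  already found.\<close>

lemma convergent_subsequence_finite_coords:
  fixes f :: "nat \<Rightarrow> 'a \<Rightarrow> real"
  assumes "finite A" "\<And>k x. x \<in> A \<Longrightarrow> f k x \<in> {0..1}"
  shows "\<exists>r l. strict_mono (r :: nat \<Rightarrow> nat) \<and> (\<forall>x\<in>A. (\<lambda>k. f (r k) x) \<longlonglongrightarrow> l x)"
  using assms
proof (induction A)
  case empty
  show ?case
    by (rule exI[of _ id]) (simp add: strict_mono_def)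
next
  case (insert x A)
  then obtain r l where r: "strict_mono r" "\<forall>x\<in>A. (\<lambda>k. f (r k) x) \<longlonglongrightarrow> l x"
    by auto
  have "\<forall>k. f (r k) x \<in> {0..1}"
    using insert.prems by blast
  then obtain c s where s: "strict_mono (s :: nat \<Rightarrow> nat)" "((\<lambda>k. f (r k) x) \<circ> s) \<longlonglongrightarrow> c"
    by (rule seq_compactE[OF compact_imp_seq_compact[OF compact_Icc]]) (rule that)
  have "(\<lambda>k. f ((r \<circ> s) k) y) \<longlonglongrightarrow> (l(x := c)) y" if "y \<in> insert x A" for y
  proof (cases "y = x")
    case True
    then show ?thesis using s(2) by (simp add: comp_def)
  next
    case False
    then show ?thesis
      using that r(2) LIMSEQ_subseq_LIMSEQ[of "\<lambda>k. f (r k) y" "l y" s] s(1) by (simp add: comp_def)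
  qed
  with strict_mono_o[OF r(1) s(1)] show ?case
    by blast
qed

text \<open>All laws live on one finite set, so no mass escapes and the coordinate limits again sum
  to 1.\<close>

lemma pmf_convergent_subsequence:
  fixes P :: "nat \<Rightarrow> 'a pmf"
  assumes A: "finite A" "\<And>k. set_pmf (P k) \<subseteq> A"
  obtains Q r where "strict_mono (r :: nat \<Rightarrow> nat)" "set_pmf Q \<subseteq> A"
    "\<And>x. (\<lambda>k. pmf (P (r k)) x) \<longlonglongrightarrow> pmf Q x"
proof -
  have P0: "pmf (P k) x = 0" if "x \<notin> A" for k x
    using A(2)[of k] that by (auto simp: set_pmf_iff)
  obtain r l where r: "strict_mono r" and lim: "\<And>x. x \<in> A \<Longrightarrow> (\<lambda>k. pmf (P (r k)) x) \<longlonglongrightarrow> l x"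
    using convergent_subsequence_finite_coords[OF A(1), of "\<lambda>k. pmf (P k)"] by (auto simp: pmf_le_1)
  have l0: "0 \<le> l x" if "x \<in> A" for x
    using lim[OF that] by (rule LIMSEQ_le_const) simp
  have "(\<lambda>k. \<Sum>x\<in>A. pmf (P (r k)) x) \<longlonglongrightarrow> (\<Sum>x\<in>A. l x)"
    using lim by (rule tendsto_sum)
  then have l1: "(\<Sum>x\<in>A. l x) = 1"
    using sum_pmf_eq_1[OF A] by (simp add: LIMSEQ_const_iff)
  define q where "q x = (if x \<in> A then l x else 0)" for x
  have "(\<integral>\<^sup>+x. ennreal (q x) \<partial>count_space UNIV) = (\<Sum>x\<in>A. ennreal (q x))"
    using A(1) by (intro nn_integral_count_space') (auto simp: q_def)
  also have "\<dots> = 1"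
    using l0 l1 by (subst sum_ennreal) (auto simp: q_def)
  finally have pmf_Q: "pmf (embed_pmf q) x = q x" for x
    using l0 by (intro pmf_embed_pmf) (auto simp: q_def)
  show ?thesis
  proof (rule that[OF r, of "embed_pmf q"])
    show "set_pmf (embed_pmf q) \<subseteq> A"
      by (auto simp: set_pmf_iff pmf_Q q_def split: if_splits)
    show "(\<lambda>k. pmf (P (r k)) x) \<longlonglongrightarrow> pmf (embed_pmf q) x" for x
      using lim[of x] by (simp add: pmf_Q q_def P0)
  qed
qed

text \<open>The delicate point is 0, where the value is 0 and agrees with the limit from the right.
  Entropy terms therefore converge even when probabilities tend to 0.\<close>

lemma continuous_on_mult_log: "continuous_on {0..} (\<lambda>t::real. t * log 2 t)"
proof (rule continuous_on_eq_continuous_within[THEN iffD2], intro ballI)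
  fix t :: real assume "t \<in> {0..}"
  then consider "t = 0" | "0 < t" by force
  then show "continuous (at t within {0..}) (\<lambda>t. t * log 2 t)"
  proof cases
    case 1
    have "((\<lambda>t::real. t * log 2 t) \<longlongrightarrow> 0) (at_right 0)"
      by real_asymp
    with 1 show ?thesis
      by (simp add: continuous_within at_within_Ici_at_right)
  next
    case 2
    then show ?thesis
      by (intro continuous_intros) auto
  qed
qed

lemma tendsto_ent:
  assumes A: "finite A" "\<And>k. set_pmf (P k) \<subseteq> A" "set_pmf Q \<subseteq> A"
    and lim: "\<And>x. (\<lambda>k. pmf (P k) x) \<longlonglongrightarrow> pmf Q x"
  shows "(\<lambda>k. ent (P k) Y) \<longlonglongrightarrow> ent Q Y"
proof -
  have "(\<lambda>k. pmf (map_pmf Y (P k)) y) \<longlonglongrightarrow> pmf (map_pmf Y Q) y" for y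
    unfolding pmf_map_eq_sum[OF A(1,2)] pmf_map_eq_sum[OF A(1,3)]
    by (intro tendsto_intros lim)
  then have "(\<lambda>k. pmf (map_pmf Y (P k)) y * log 2 (pmf (map_pmf Y (P k)) y))
      \<longlonglongrightarrow> pmf (map_pmf Y Q) y * log 2 (pmf (map_pmf Y Q) y)" for y
    by (rule continuous_on_tendsto_compose[OF continuous_on_mult_log]) simp_all
  then show ?thesis
    unfolding ent_eq_sum[OF A(1,2)] ent_eq_sum[OF A(1,3)] by (rule tendsto_minus[OF tendsto_sum])
qed

text \<open>A point of the closure is a limit of achievable pairs. The \<open>k\<close>-th pair
  meets the bounds with slack \<open>1 / Suc k\<close> under some law; a subsequence of these laws
  converges to one that meets them exactly.\<close>

lemma capacity_region_fb_subset:
  fixes f1 :: "nat \<Rightarrow> 'x::finite list \<Rightarrow> 'y1::finite" and f2 :: "nat \<Rightarrow> 'x list \<Rightarrow> 'y2::finite"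
  assumes L: "0 < L"
  shows "capacity_region_fb L f1 f2 fb N
    \<subseteq> (\<Union>P \<in> {P. set_pmf P \<subseteq> {xs. length xs = L}}. rate_region L f1 f2 P)"
proof safe
  fix R1 R2 assume "(R1, R2) \<in> capacity_region_fb L f1 f2 fb N"
  then obtain p where p: "\<And>k. p k \<in> {(R1, R2). achievable L f1 f2 N (fb_transmitters L fb) R1 R2}"
    and lim: "p \<longlonglongrightarrow> (R1, R2)"
    unfolding capacity_region_fb_def closure_sequential by blast
  let ?Y1 = "receive L f1" and ?Y2 = "receive L f2"
  let ?Y12 = "\<lambda>xs. (receive L f1 xs, receive L f2 xs)"
  have "\<forall>k. \<exists>P. set_pmf P \<subseteq> {xs. length xs = L} \<and> 0 \<le> fst (p k) \<and> 0 \<le> snd (p k) \<and>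
      L * fst (p k) \<le> ent P ?Y1 + inverse (real (Suc k)) \<and> L * snd (p k) \<le> ent P ?Y2 + inverse (real (Suc k)) \<and>
      L * (fst (p k) + snd (p k)) \<le> ent P ?Y12 + inverse (real (Suc k))"
  proof
    fix k
    have ach: "achievable L f1 f2 N (fb_transmitters L fb) (fst (p k)) (snd (p k))"
      using p[of k] by (simp add: case_prod_unfold)
    show "\<exists>P. set_pmf P \<subseteq> {xs. length xs = L} \<and> 0 \<le> fst (p k) \<and> 0 \<le> snd (p k) \<and>
      L * fst (p k) \<le> ent P ?Y1 + inverse (real (Suc k)) \<and> L * snd (p k) \<le> ent P ?Y2 + inverse (real (Suc k)) \<and>
      L * (fst (p k) + snd (p k)) \<le> ent P ?Y12 + inverse (real (Suc k))"
    proof (rule near_rate_region[OF L _ ach])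
      show "0 < inverse (real (Suc k))"
        by simp
    qed (auto simp: length_fb_transmitters)
  qed
  from choice[OF this] obtain P where P: "\<And>k. set_pmf (P k) \<subseteq> {xs. length xs = L}"
    and p0: "\<And>k. 0 \<le> fst (p k)" "\<And>k. 0 \<le> snd (p k)"
    and le: "\<And>k. L * fst (p k) \<le> ent (P k) ?Y1 + inverse (real (Suc k))"
      "\<And>k. L * snd (p k) \<le> ent (P k) ?Y2 + inverse (real (Suc k))"
      "\<And>k. L * (fst (p k) + snd (p k)) \<le> ent (P k) ?Y12 + inverse (real (Suc k))"
    by blast
  obtain Q r where r: "strict_mono r" and Q: "set_pmf Q \<subseteq> {xs. length xs = L}"
    and limP: "\<And>x. (\<lambda>k. pmf (P (r k)) x) \<longlonglongrightarrow> pmf Q x"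
    by (rule pmf_convergent_subsequence[where P = P, OF finite_lists_length P]) (rule that)
  have p1: "(\<lambda>k. fst (p (r k))) \<longlonglongrightarrow> R1" and p2: "(\<lambda>k. snd (p (r k))) \<longlonglongrightarrow> R2"
    using tendsto_fst[OF lim] tendsto_snd[OF lim] r by (auto dest: LIMSEQ_subseq_LIMSEQ simp: comp_def)
  have ent: "(\<lambda>k. ent (P (r k)) Y + inverse (real (Suc (r k)))) \<longlonglongrightarrow> ent Q Y" for Y :: "'x list \<Rightarrow> 'd"
    using tendsto_add[OF tendsto_ent[where P = "\<lambda>k. P (r k)", OF finite_lists_length P Q limP, of Y]
        LIMSEQ_subseq_LIMSEQ[OF LIMSEQ_inverse_real_of_nat r]] by (simp add: comp_def)
  have R: "0 \<le> R1" "0 \<le> R2"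
    using p0 by (auto intro: LIMSEQ_le_const[OF p1] LIMSEQ_le_const[OF p2])
  have "L * R1 \<le> ent Q ?Y1"
    using le by (intro LIMSEQ_le[OF tendsto_mult_left[OF p1] ent]) auto
  moreover have "L * R2 \<le> ent Q ?Y2"
    using le by (intro LIMSEQ_le[OF tendsto_mult_left[OF p2] ent]) auto
  moreover have "L * (R1 + R2) \<le> ent Q ?Y12"
    using le by (intro LIMSEQ_le[OF tendsto_mult_left[OF tendsto_add[OF p1 p2]] ent]) auto
  moreover have "finite (set_pmf Q)"
    using Q finite_lists_length finite_subset by blast
  ultimately have "(R1, R2) \<in> rate_region L f1 f2 Q"
    using L R by (simp add: rate_region_def bit_entropy_eq_ent pos_le_divide_eq mult.commute)
  with Q show "(R1, R2) \<in> (\<Union>P \<in> {P. set_pmf P \<subseteq> {xs. length xs = L}}. rate_region L f1 f2 P)"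
    by blast
qed

theorem mainTheorem9:
  fixes L :: nat
    and f1 :: "nat \<Rightarrow> 'x::finite list \<Rightarrow> 'y1::finite"
    and f2 :: "nat \<Rightarrow> 'x list \<Rightarrow> 'y2::finite"
    and fb :: "nat \<Rightarrow> 'x list \<Rightarrow> 'z \<Rightarrow> 'f::finite"
    and N :: "'z pmf"
  assumes "0 < L"
  shows "capacity_region_nofb L f1 f2 N
           = (\<Union>P \<in> {P. set_pmf P \<subseteq> {xs. length xs = L}}. rate_region L f1 f2 P) \<and>
         capacity_region_fb L f1 f2 fb N
           = (\<Union>P \<in> {P. set_pmf P \<subseteq> {xs. length xs = L}}. rate_region L f1 f2 P)"
proof -
  \<comment> \<open>The three inclusions close a cycle: region, capacity without feedback, capacity
    with feedback, region.\<close>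
  have "(\<Union>P \<in> {P. set_pmf P \<subseteq> {xs. length xs = L}}. rate_region L f1 f2 P)
      \<subseteq> capacity_region_nofb L f1 f2 N"
    using rate_region_subset_nofb[OF assms, of _ f1 f2 N] by (simp add: UN_subset_iff)
  moreover note nofb_subset_fb[of L f1 f2 N fb] capacity_region_fb_subset[OF assms, of f1 f2 fb N]
  ultimately show ?thesis
    by (intro conjI; order)
qed

end
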